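(* Let $A$ and $B$ be positive operators on a Hilbert space $\mathcal H$ satisfying $m\leq A\leq M$ with $0<m<M$ and $A\leq B$. Let $s,p,q$ be real numbers with $0<s<p<1$, $0<s\leq q<1$, and $M^{p-1}q\leq\frac{M^{p}-m^{p}}{M-m}\leq m^{p-1}q$. Then $$A^p\leq 2^{2(1-s)}\max\{m^{p-q},M^{p-q}\}\, B^{q}.$$
   Context: A bounded linear operator $A$ on $\mathcal H$ is positive if $\langle Ax,x\rangle\geq 0$ for all $x\in\mathcal H$; for self-adjoint operators, $A\leq B$ means $B-A$ is positive, and scalars $m,M$ in operator inequalities stand for $mI,MI$. Powers are defined by the continuous functional calculus. *)

theory Defs
  imports "HOL-Analysis.Analysis"
begin

text \<open>
  Complex inner product spaces, with the inner product linear in the first argument. The norm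
  inherited from \<^class>\<open>real_normed_vector\<close> is tied to the inner product, and the real scalar
  multiplication to the complex one.
\<close>

class complex_inner = real_normed_vector +
  fixes scaleC :: "complex \<Rightarrow> 'a \<Rightarrow> 'a"  (infixr "*\<^sub>C" 75)
    and cinner :: "'a \<Rightarrow> 'a \<Rightarrow> complex"
  assumes scaleR_scaleC: "r *\<^sub>R x = complex_of_real r *\<^sub>C x"
    and scaleC_add_right: "c *\<^sub>C (x + y) = c *\<^sub>C x + c *\<^sub>C y"
    and scaleC_add_left: "(c + d) *\<^sub>C x = c *\<^sub>C x + d *\<^sub>C x"
    and scaleC_scaleC: "c *\<^sub>C d *\<^sub>C x = (c * d) *\<^sub>C x"
    and scaleC_one: "1 *\<^sub>C x = x"
    and cinner_commute: "cinner x y = cnj (cinner y x)"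
    and cinner_add_left: "cinner (x + y) z = cinner x z + cinner y z"
    and cinner_scaleC_left: "cinner (c *\<^sub>C x) y = c * cinner x y"
    and cinner_ge_zero: "0 \<le> Re (cinner x x)"
    and cinner_eq_zero_iff: "cinner x x = 0 \<longleftrightarrow> x = 0"
    and norm_eq_sqrt_cinner: "norm x = sqrt (Re (cinner x x))"

class chilbert_space = complex_inner + complete_space

instantiation complex :: chilbert_space
begin

definition scaleC_complex :: "complex \<Rightarrow> complex \<Rightarrow> complex"
  where "scaleC_complex c x = c * x"

definition cinner_complex :: "complex \<Rightarrow> complex \<Rightarrow> complex"
  where "cinner_complex x y = x * cnj y"

instance
proof
  fix x :: complex
  show "(cinner x x = 0) = (x = 0)" by (simp add: cinner_complex_def)
  show "norm x = sqrt (Re (cinner x x))"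
    by (simp add: cinner_complex_def cmod_def power2_eq_square)
qed (auto simp: scaleC_complex_def cinner_complex_def scaleR_conv_of_real algebra_simps)

end

text \<open>
  The type \<open>'a \<Rightarrow>\<^sub>L 'a\<close> consists of the bounded real-linear maps; the bounded operators on the
  complex Hilbert space are those that are moreover complex-linear. The operator norm is the same.
\<close>

definition bounded_op :: "('a::chilbert_space \<Rightarrow>\<^sub>L 'a) \<Rightarrow> bool" where
  "bounded_op A \<longleftrightarrow> (\<forall>c x. A (c *\<^sub>C x) = c *\<^sub>C A x)"

definition positive_op :: "('a::chilbert_space \<Rightarrow>\<^sub>L 'a) \<Rightarrow> bool" where
  "positive_op A \<longleftrightarrow>
     bounded_op A \<and> (\<forall>x. cinner (A x) x \<in> \<real> \<and> 0 \<le> Re (cinner (A x) x))"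

definition op_le :: "('a::chilbert_space \<Rightarrow>\<^sub>L 'a) \<Rightarrow> ('a \<Rightarrow>\<^sub>L 'a) \<Rightarrow> bool"  (infix "\<preceq>" 50) where
  "A \<preceq> B \<longleftrightarrow> positive_op (B - A)"

definition spectrum :: "('a::chilbert_space \<Rightarrow>\<^sub>L 'a) \<Rightarrow> complex set" where
  "spectrum A = {l. \<not> (\<exists>S. bounded_op S \<and>
     (\<forall>x. S (A x - l *\<^sub>C x) = x) \<and> (\<forall>x. A (S x) - l *\<^sub>C S x = x))}"

text \<open>
  \<open>\<Phi>\<close> is a continuous functional calculus for \<open>A\<close>: a contractive unital \<open>*\<close>-homomorphism from the
  continuous functions on the spectrum to the bounded operators that maps the identity function
  to \<open>A\<close>. Functions are total here, and only those continuous on the spectrum are constrained; by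
  linearity and contractivity \<open>\<Phi> f\<close> depends only on the restriction of \<open>f\<close> to the spectrum.
  Contractivity is stated without a supremum since the spectrum is empty on the zero space.
\<close>

definition is_cfc ::
  "('a::chilbert_space \<Rightarrow>\<^sub>L 'a) \<Rightarrow> ((complex \<Rightarrow> complex) \<Rightarrow> ('a \<Rightarrow>\<^sub>L 'a)) \<Rightarrow> bool" where
  "is_cfc A \<Phi> \<longleftrightarrow>
     \<Phi> (\<lambda>z. 1) = id_blinfun \<and>
     \<Phi> (\<lambda>z. z) = A \<and>
     (\<forall>f. continuous_on (spectrum A) f \<longrightarrow>
        bounded_op (\<Phi> f) \<and>
        (\<forall>c x. \<Phi> (\<lambda>z. c * f z) x = c *\<^sub>C \<Phi> f x) \<and>
        (\<forall>x y. cinner (\<Phi> f x) y = cinner x (\<Phi> (\<lambda>z. cnj (f z)) y)) \<and>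
        (\<forall>C\<ge>0. (\<forall>z\<in>spectrum A. cmod (f z) \<le> C) \<longrightarrow> norm (\<Phi> f) \<le> C)) \<and>
     (\<forall>f g. continuous_on (spectrum A) f \<longrightarrow> continuous_on (spectrum A) g \<longrightarrow>
        \<Phi> (\<lambda>z. f z + g z) = \<Phi> f + \<Phi> g \<and>
        \<Phi> (\<lambda>z. f z * g z) = \<Phi> f o\<^sub>L \<Phi> g)"

text \<open>
  For self-adjoint (more generally normal) \<open>A\<close> such a \<open>\<Phi>\<close> exists, and by the Weierstrass theorem
  it is unique on functions continuous on the spectrum, so the choice below is immaterial there.
\<close>

definition cfc :: "('a::chilbert_space \<Rightarrow>\<^sub>L 'a) \<Rightarrow> (complex \<Rightarrow> complex) \<Rightarrow> ('a \<Rightarrow>\<^sub>L 'a)" where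
  "cfc A = (SOME \<Phi>. is_cfc A \<Phi>)"

text \<open>
  Intended for positive \<open>A\<close>, whose spectrum lies in \<open>[0, \<infinity>)\<close>, and exponent \<open>r > 0\<close>, so that the
  function below is continuous on the spectrum (note \<open>0 powr r = 0\<close>).
\<close>

definition op_powr :: "('a::chilbert_space \<Rightarrow>\<^sub>L 'a) \<Rightarrow> real \<Rightarrow> ('a \<Rightarrow>\<^sub>L 'a)" where
  "op_powr A r = cfc A (\<lambda>z. complex_of_real (Re z powr r))"

end

theory Submission
  imports Defs "HOL-Computational_Algebra.Fundamental_Theorem_Algebra"
begin

text \<open>
  The result is a consequence of the Loewner--Heinz inequality: for \<open>0 \<le> q \<le> 1\<close>, \<open>A \<preceq> B\<close> implies
  \<open>A\<^sup>q \<preceq> B\<^sup>q\<close>. Since \<open>t powr (p - q)\<close> is monotone in \<open>t\<close>, it is bounded on \<open>[m, M]\<close> by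
  \<open>L = max (m powr (p - q)) (M powr (p - q))\<close>, so the functional calculus gives
  \<open>A\<^sup>p = A powr (q/2) \<cdot> A powr (p - q) \<cdot> A powr (q/2) \<preceq> L A\<^sup>q\<close>; then \<open>L A\<^sup>q \<preceq> L B\<^sup>q\<close>, and the factor
  \<open>2 powr (2 (1 - s)) \<ge> 1\<close> only enlarges the right-hand side.

  Most of the work goes into showing that \<^const>\<open>cfc\<close> really selects a continuous functional
  calculus of a self-adjoint operator \<open>A\<close> (\<open>is_cfc_cfc\<close>). A coercive operator is invertible, by
  the contraction principle, and this alone locates the spectrum in the real interval spanned by the
  numerical range and shows that it is closed. For a polynomial \<open>p\<close>, the square of the
  norm of \<open>p(A)\<close> is a spectral value of \<open>p(A)\<^sup>* p(A)\<close>; factoring over the complex numbers makes it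
  a value of \<open>\<bar>p\<bar>\<^sup>2\<close> on the spectrum of \<open>A\<close>. So \<open>norm p(A)\<close> is at most the supremum of \<open>\<bar>p\<bar>\<close> on
  the spectrum (\<open>norm_polyop_le\<close>), and by the Weierstrass theorem the polynomial calculus
  extends to continuous functions.

  The Loewner--Heinz inequality is then proved by Pedersen's argument. The exponents \<open>r\<close> in
  \<open>[0, 1]\<close> with \<open>A\<^sup>r \<preceq> B\<^sup>r\<close> form a closed set that contains \<open>0\<close> and \<open>1\<close>; it is enough that the
  set is closed under midpoints (\<open>op_powr_le_midpoint\<close>), which follows from comparing the powers of
  a self-adjoint operator with those of a contraction similar to it.
\<close>

section \<open>Complex inner products\<close>

instance chilbert_space \<subseteq> banach ..

lemma cinner_add_right: "cinner x (y + z) = cinner x y + cinner x (z::'a::complex_inner)"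
  by (metis cinner_add_left cinner_commute complex_cnj_add)

lemma cinner_scaleC_right: "cinner x (c *\<^sub>C y) = cnj c * cinner x (y::'a::complex_inner)"
  by (metis cinner_scaleC_left cinner_commute complex_cnj_mult)

lemma scaleC_minus_one: "(-1) *\<^sub>C x = - (x::'a::complex_inner)"
  by (metis of_real_1 of_real_minus scaleR_minus1_left scaleR_scaleC)

lemma cinner_minus_left: "cinner (- x) y = - cinner x (y::'a::complex_inner)"
  by (metis cinner_scaleC_left mult_minus1 scaleC_minus_one)

lemma cinner_minus_right: "cinner x (- y) = - cinner x (y::'a::complex_inner)"
  by (metis cinner_minus_left cinner_commute complex_cnj_minus)

lemma cinner_diff_left: "cinner (x - y) z = cinner x z - cinner y (z::'a::complex_inner)"
  by (metis cinner_add_left cinner_minus_left diff_conv_add_uminus)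

lemma cinner_diff_right: "cinner x (y - z) = cinner x y - cinner x (z::'a::complex_inner)"
  by (metis cinner_add_right cinner_minus_right diff_conv_add_uminus)

lemma cinner_zero_left [simp]: "cinner 0 (x::'a::complex_inner) = 0"
  using cinner_diff_left[of x x x] by simp

lemma cinner_zero_right [simp]: "cinner (x::'a::complex_inner) 0 = 0"
  using cinner_diff_right[of x x x] by simp

lemma cinner_scaleR_left: "cinner (r *\<^sub>R x) y = of_real r * cinner x (y::'a::complex_inner)"
  by (simp add: scaleR_scaleC cinner_scaleC_left)

lemma cinner_self: "cinner x x = of_real ((norm (x::'a::complex_inner))\<^sup>2)"
proof -
  have "Im (cinner x x) = 0"
    using arg_cong[OF cinner_commute[of x x], of Im] by simp
  then show ?thesis
    by (simp add: complex_eq_iff norm_eq_sqrt_cinner cinner_ge_zero)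
qed

lemma norm_scaleC: "norm (c *\<^sub>C x) = cmod c * norm (x::'a::complex_inner)"
proof -
  have "complex_of_real ((norm (c *\<^sub>C x))\<^sup>2) = (c * cnj c) * cinner x x"
    unfolding cinner_self[symmetric] cinner_scaleC_left cinner_scaleC_right by (simp only: ac_simps)
  also have "\<dots> = of_real ((cmod c * norm x)\<^sup>2)"
    unfolding complex_norm_square[symmetric] cinner_self power_mult_distrib by (simp only: of_real_mult)
  finally have "(norm (c *\<^sub>C x))\<^sup>2 = (cmod c * norm x)\<^sup>2"
    unfolding of_real_eq_iff .
  then show ?thesis
    by (rule power2_eq_imp_eq) simp_all
qed

lemma norm_diff_square:
  "(norm (x - y))\<^sup>2 = (norm x)\<^sup>2 - 2 * Re (cinner x y) + (norm (y::'a::complex_inner))\<^sup>2"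
proof -
  have "(norm (x - y))\<^sup>2 = Re (cinner (x - y) (x - y))"
    by (simp add: cinner_self)
  also have "\<dots> = (norm x)\<^sup>2 - Re (cinner x y) - Re (cinner y x) + (norm y)\<^sup>2"
    by (simp add: cinner_diff_left cinner_diff_right) (simp add: cinner_self)
  also have "Re (cinner y x) = Re (cinner x y)"
    by (subst cinner_commute) simp
  finally show ?thesis by simp
qed

lemma cinner_Cauchy_Schwarz: "cmod (cinner x y) \<le> norm x * norm (y::'a::complex_inner)"
proof (cases "y = 0")
  case False
  \<comment> \<open>\<open>c *\<^sub>C y\<close> is the orthogonal projection of \<open>x\<close> onto the line spanned by \<open>y\<close>.\<close>
  define c where "c = cinner x y / of_real ((norm y)\<^sup>2)"
  have "Re (cinner x (c *\<^sub>C y)) = (cmod (cinner x y))\<^sup>2 / (norm y)\<^sup>2"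
  proof -
    have "cinner x (c *\<^sub>C y) = of_real ((cmod (cinner x y))\<^sup>2 / (norm y)\<^sup>2)"
      using complex_norm_square[of "cinner x y"]
      by (simp add: c_def cinner_scaleC_right mult.commute)
    then show ?thesis by simp
  qed
  moreover have "(norm (c *\<^sub>C y))\<^sup>2 = (cmod (cinner x y))\<^sup>2 / (norm y)\<^sup>2"
    using False
    by (simp add: norm_scaleC c_def norm_divide norm_power power_mult_distrib power_divide)
      (simp add: power2_eq_square power4_eq_xxxx)
  ultimately have "0 \<le> (norm x)\<^sup>2 - (cmod (cinner x y))\<^sup>2 / (norm y)\<^sup>2"
    using norm_diff_square[of x "c *\<^sub>C y"] zero_le_power2[of "norm (x - c *\<^sub>C y)"] by linarith
  then have "(cmod (cinner x y))\<^sup>2 \<le> (norm x * norm y)\<^sup>2"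
    using False by (simp add: field_simps)
  then show ?thesis
    by (rule power2_le_imp_le) simp
qed simp

section \<open>Bounded operators and invertibility\<close>

text \<open>
  Multiplication by a complex scalar has to be an operator of its own, since the type of bounded
  maps carries only the real scalar multiplication.
\<close>

definition cscale :: "complex \<Rightarrow> ('a::chilbert_space \<Rightarrow>\<^sub>L 'a)" where
  "cscale c = Blinfun (\<lambda>x. c *\<^sub>C x)"

lemma scaleC_scaleR_commute: "c *\<^sub>C (r *\<^sub>R x) = r *\<^sub>R (c *\<^sub>C (x::'a::complex_inner))"
  by (simp add: scaleR_scaleC scaleC_scaleC mult.commute)

lemma cscale_apply [simp]: "cscale c x = c *\<^sub>C x"
proof -
  have "bounded_linear (\<lambda>x::'a. c *\<^sub>C x)"
    by (rule bounded_linear_intro[where K = "cmod c"])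
      (auto simp: scaleC_add_right scaleC_scaleR_commute norm_scaleC)
  then show ?thesis
    by (simp add: cscale_def bounded_linear_Blinfun_apply)
qed

lemma scaleC_zero_left [simp]: "0 *\<^sub>C (x::'a::complex_inner) = 0"
  by (metis of_real_0 scaleR_scaleC scaleR_zero_left)

lemma scaleC_zero_right [simp]: "c *\<^sub>C (0::'a::complex_inner) = 0"
  using scaleC_add_right[of c 0 "0::'a"] by simp

lemma scaleC_diff_right: "c *\<^sub>C (x - y) = c *\<^sub>C x - c *\<^sub>C (y::'a::complex_inner)"
  by (metis add_diff_cancel_right' diff_add_cancel scaleC_add_right)

lemma bounded_op_compose: "bounded_op A \<Longrightarrow> bounded_op B \<Longrightarrow> bounded_op (A o\<^sub>L B)"
  by (simp add: bounded_op_def)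

lemma bounded_op_add: "bounded_op A \<Longrightarrow> bounded_op B \<Longrightarrow> bounded_op (A + B)"
  by (simp add: bounded_op_def blinfun.add_left scaleC_add_right)

lemma bounded_op_diff: "bounded_op A \<Longrightarrow> bounded_op B \<Longrightarrow> bounded_op (A - B)"
  by (simp add: bounded_op_def blinfun.diff_left scaleC_diff_right)

lemma bounded_op_scaleR: "bounded_op A \<Longrightarrow> bounded_op (r *\<^sub>R A)"
  by (simp add: bounded_op_def blinfun.scaleR_left scaleC_scaleR_commute)

lemma bounded_op_cscale [simp]: "bounded_op (cscale c)"
  by (simp add: bounded_op_def scaleC_scaleC mult.commute)

definition invertible_op :: "('a::chilbert_space \<Rightarrow>\<^sub>L 'a) \<Rightarrow> bool" where
  "invertible_op T \<longleftrightarrow> (\<exists>S. bounded_op S \<and> (\<forall>x. S (T x) = x) \<and> (\<forall>x. T (S x) = x))"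

lemma in_spectrum_iff: "l \<in> spectrum A \<longleftrightarrow> \<not> invertible_op (A - cscale l)"
  by (simp add: spectrum_def invertible_op_def blinfun.diff_left)

lemma invertible_op_compose:
  assumes "invertible_op T" "invertible_op U" shows "invertible_op (T o\<^sub>L U)"
proof -
  obtain S V where "bounded_op S" "\<And>x. S (T x) = x" "\<And>x. T (S x) = x"
    and "bounded_op V" "\<And>x. V (U x) = x" "\<And>x. U (V x) = x"
    using assms unfolding invertible_op_def by blast
  then show ?thesis
    unfolding invertible_op_def
    by (intro exI[of _ "V o\<^sub>L S"]) (simp add: bounded_op_compose)
qed

lemma invertible_op_cscale: "c \<noteq> 0 \<Longrightarrow> invertible_op (cscale c)"
  unfolding invertible_op_def
  by (rule exI[of _ "cscale (inverse c)"]) (simp add: scaleC_scaleC scaleC_one)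

lemma invertible_op_cscale_cancel:
  assumes "invertible_op (cscale c o\<^sub>L T)" "c \<noteq> 0" shows "invertible_op T"
proof -
  have "T = cscale (inverse c) o\<^sub>L (cscale c o\<^sub>L T)"
    using assms(2) by (auto intro!: blinfun_eqI simp: scaleC_scaleC scaleC_one)
  then show ?thesis
    using invertible_op_compose[OF invertible_op_cscale assms(1), of "inverse c"] assms(2) by simp
qed

section \<open>Location of the spectrum\<close>

text \<open>
  This is the Lax--Milgram lemma. For small \<open>t > 0\<close> the map \<open>x \<mapsto> x - t (T x - y)\<close> is a contraction,
  and its fixed point solves \<open>T x = y\<close>; coercivity also bounds \<open>T\<close> from below, which makes the
  solution unique and a bounded function of \<open>y\<close>. Every proof below that a number lies outside the
  spectrum goes back to this lemma.
\<close>

lemma coercive_imp_invertible_op: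
  fixes T :: "'a::chilbert_space \<Rightarrow>\<^sub>L 'a"
  assumes T: "bounded_op T" and d: "0 < d"
    and coer: "\<And>x. d * (norm x)\<^sup>2 \<le> Re (cinner (T x) x)"
  shows "invertible_op T"
proof -
  have below: "d * norm x \<le> norm (T x)" for x
  proof (cases "x = 0")
    case False
    have "d * norm x * norm x \<le> norm (T x) * norm x"
      using coer[of x] complex_Re_le_cmod[of "cinner (T x) x"] cinner_Cauchy_Schwarz[of "T x" x]
      unfolding power2_eq_square mult.assoc by linarith
    then show ?thesis using False by simp
  qed simp
  \<comment> \<open>Any \<open>K\<close> above both squares works: with \<open>t = d / K\<close> the Lipschitz constant squared is
    \<open>1 - 2 t d + t\<^sup>2 (norm T)\<^sup>2 \<le> 1 - d\<^sup>2 / K\<close>.\<close>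
  define K where "K = (norm T)\<^sup>2 + d\<^sup>2 + 1"
  have K: "K > 0" "(norm T)\<^sup>2 \<le> K" "d\<^sup>2 < K"
    using zero_le_power2[of "norm T"] zero_le_power2[of d] unfolding K_def by linarith+
  define t where "t = d / K"
  define c where "c = 1 - d\<^sup>2 / K"
  have c: "0 \<le> c" "c < 1"
    using K d by (auto simp: c_def)
  have contr: "(norm (x - t *\<^sub>R T x))\<^sup>2 \<le> c * (norm x)\<^sup>2" for x
  proof -
    have "(norm (x - t *\<^sub>R T x))\<^sup>2
        = (norm x)\<^sup>2 - 2 * t * Re (cinner (T x) x) + t\<^sup>2 * (norm (T x))\<^sup>2"
    proof -
      have "Re (cinner x (t *\<^sub>R T x)) = t * Re (cinner (T x) x)"
        by (subst cinner_commute) (simp add: cinner_scaleR_left)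
      then show ?thesis by (simp add: norm_diff_square power_mult_distrib)
    qed
    also have "\<dots> \<le> (norm x)\<^sup>2 - 2 * t * (d * (norm x)\<^sup>2) + t\<^sup>2 * (K * (norm x)\<^sup>2)"
    proof -
      have "(norm (T x))\<^sup>2 \<le> (norm T * norm x)\<^sup>2"
        by (intro power_mono norm_blinfun) simp
      also have "\<dots> \<le> K * (norm x)\<^sup>2"
        using K by (simp add: power_mult_distrib mult_right_mono)
      finally have "t\<^sup>2 * (norm (T x))\<^sup>2 \<le> t\<^sup>2 * (K * (norm x)\<^sup>2)"
        by (simp add: mult_left_mono)
      moreover have "2 * t * (d * (norm x)\<^sup>2) \<le> 2 * t * Re (cinner (T x) x)"
        using coer[of x] K d by (intro mult_left_mono) (auto simp: t_def)
      ultimately show ?thesis by linarith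
    qed
    also have "\<dots> = c * (norm x)\<^sup>2"
      using K by (simp add: t_def c_def field_simps power2_eq_square)
    finally show ?thesis .
  qed
  have lip: "dist (x - t *\<^sub>R (T x - y)) (x' - t *\<^sub>R (T x' - y)) \<le> sqrt c * dist x x'" for x x' y
  proof -
    have eq: "x - t *\<^sub>R (T x - y) - (x' - t *\<^sub>R (T x' - y)) = (x - x') - t *\<^sub>R T (x - x')"
      by (simp add: blinfun.diff_right algebra_simps)
    have "(dist (x - t *\<^sub>R (T x - y)) (x' - t *\<^sub>R (T x' - y)))\<^sup>2 \<le> (sqrt c * dist x x')\<^sup>2"
      using contr[of "x - x'"] c unfolding dist_norm power_mult_distrib eq by simp
    then show ?thesis
      by (rule power2_le_imp_le) (use c in simp)
  qed
  have t: "t \<noteq> 0" using d K by (simp add: t_def)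
  have surj: "\<exists>x. T x = y" for y
  proof -
    have "\<exists>!x. x - t *\<^sub>R (T x - y) = x"
      using c lip by (intro banach_fix_type[of "sqrt c"]) (auto simp: real_less_lsqrt)
    then obtain x where "x - t *\<^sub>R (T x - y) = x" by blast
    then have "t *\<^sub>R (T x - y) = 0" by (metis add_diff_cancel_left' cancel_comm_monoid_add_class.diff_cancel diff_diff_eq2)
    then show ?thesis using t by auto
  qed
  have inj: "x = x'" if "T x = T x'" for x x'
    using below[of "x - x'"] that d by (simp add: blinfun.diff_right mult_le_0_iff)
  define S where "S y = (SOME x. T x = y)" for y
  have TS: "T (S y) = y" for y
    unfolding S_def by (rule someI_ex[OF surj])
  have ST: "S (T x) = x" for x by (rule inj) (rule TS)
  have bl: "bounded_linear S"
  proof (rule bounded_linear_intro[where K = "inverse d"])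
    show "S (x + y) = S x + S y" for x y
      by (rule inj) (simp add: TS blinfun.add_right)
    show "S (r *\<^sub>R x) = r *\<^sub>R S x" for r x
      by (rule inj) (simp add: TS blinfun.scaleR_right)
    show "norm (S x) \<le> norm x * inverse d" for x
      using below[of "S x"] d by (simp add: TS field_simps)
  qed
  have [simp]: "blinfun_apply (Blinfun S) = S"
    by (rule bounded_linear_Blinfun_apply[OF bl])
  have "bounded_op (Blinfun S)"
    unfolding bounded_op_def
  proof (intro allI)
    show "Blinfun S (c *\<^sub>C x) = c *\<^sub>C Blinfun S x" for c x
      using inj[of "S (c *\<^sub>C x)" "c *\<^sub>C S x"] T by (simp add: TS bounded_op_def)
  qed
  then show ?thesis
    unfolding invertible_op_def by (intro exI[of _ "Blinfun S"]) (simp add: TS ST)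
qed

text \<open>
  The scalar \<open>c\<close> is there to rotate \<open>A - l\<close> until its numerical range lies in a right half-plane.
\<close>

lemma not_in_spectrumI:
  fixes A :: "'a::chilbert_space \<Rightarrow>\<^sub>L 'a"
  assumes A: "bounded_op A" and d: "0 < d" and c: "c \<noteq> 0"
    and coer: "\<And>x. d * (norm x)\<^sup>2 \<le> Re (c * (cinner (A x) x - l * of_real ((norm x)\<^sup>2)))"
  shows "l \<notin> spectrum A"
proof -
  have "invertible_op (cscale c o\<^sub>L (A - cscale l))"
  proof (rule coercive_imp_invertible_op[OF _ d])
    show "bounded_op (cscale c o\<^sub>L (A - cscale l))"
      by (intro bounded_op_compose bounded_op_diff A bounded_op_cscale)
    show "d * (norm x)\<^sup>2 \<le> Re (cinner ((cscale c o\<^sub>L (A - cscale l)) x) x)" for x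
      using coer[of x]
      by (simp add: blinfun.diff_left cinner_scaleC_left cinner_diff_left) (simp add: cinner_self)
  qed
  then show ?thesis
    using c by (auto simp: in_spectrum_iff dest: invertible_op_cscale_cancel)
qed

text \<open>
  If \<open>S\<close> inverts \<open>A - l\<close>, then \<open>S (A - k) = 1 + (l - k) S\<close>, which is coercive for \<open>k\<close> close
  to \<open>l\<close>.
\<close>

lemma closed_spectrum:
  fixes A :: "'a::chilbert_space \<Rightarrow>\<^sub>L 'a"
  assumes A: "bounded_op A" shows "closed (spectrum A)"
proof -
  have "open (- spectrum A)"
  proof (subst open_contains_ball, safe)
    fix l assume "l \<notin> spectrum A"
    then obtain S where S: "bounded_op S" "\<And>x. S ((A - cscale l) x) = x" "\<And>x. (A - cscale l) (S x) = x"
      by (auto simp: in_spectrum_iff invertible_op_def)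
    \<comment> \<open>The radius makes the perturbation \<open>(l - k) S\<close> have norm at most \<open>1 / 2\<close>; the summand
      \<open>1\<close> covers \<open>S = 0\<close>, which occurs on the zero space.\<close>
    define e where "e = 1 / (2 * (norm S + 1))"
    have e: "e > 0" "norm S * e \<le> 1 / 2"
      using norm_ge_zero[of S] by (auto simp: e_def divide_simps add_nonneg_pos)
    show "\<exists>e>0. ball l e \<subseteq> - spectrum A"
    proof (intro exI[of _ e] conjI subsetI ComplI)
      fix k assume k: "k \<in> ball l e" "k \<in> spectrum A"
      define U where "U = A - cscale k"
      have SU: "S (U x) = x + (l - k) *\<^sub>C S x" for x
      proof -
        have "U x = (A - cscale l) x + (l - k) *\<^sub>C x"
          using scaleC_add_left[of "l - k" k x] by (simp add: U_def blinfun.diff_left)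
        then show ?thesis using S by (simp add: blinfun.add_right bounded_op_def)
      qed
      have US: "U (S x) = x + (l - k) *\<^sub>C S x" for x
      proof -
        have "U (S x) = (A - cscale l) (S x) + (l - k) *\<^sub>C S x"
          using scaleC_add_left[of "l - k" k "S x"] by (simp add: U_def blinfun.diff_left)
        then show ?thesis using S by simp
      qed
      have U: "bounded_op U" using A by (simp add: U_def bounded_op_diff)
      have "invertible_op (S o\<^sub>L U)"
      proof (rule coercive_imp_invertible_op[where d = "1/2"])
        show "1/2 * (norm x)\<^sup>2 \<le> Re (cinner ((S o\<^sub>L U) x) x)" for x
        proof -
          have "cmod (cinner ((l - k) *\<^sub>C S x) x) \<le> norm ((l - k) *\<^sub>C S x) * norm x"
            by (rule cinner_Cauchy_Schwarz)
          also have "\<dots> \<le> (e * (norm S * norm x)) * norm x"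
            using k(1) e(1) by (intro mult_right_mono) (auto simp: norm_scaleC dist_norm intro!: mult_mono norm_blinfun)
          also have "\<dots> \<le> 1/2 * (norm x)\<^sup>2"
            using mult_right_mono[OF e(2), of "norm x * norm x"]
            by (simp add: power2_eq_square mult_ac)
          finally show ?thesis
            using abs_Re_le_cmod[of "cinner ((l - k) *\<^sub>C S x) x"]
            by (simp add: SU cinner_add_left) (simp add: cinner_self)
        qed
      qed (simp_all add: S U bounded_op_compose)
      then obtain V where V: "bounded_op V" "\<And>x. V (S (U x)) = x" "\<And>x. S (U (V x)) = x"
        by (auto simp: invertible_op_def)
      \<comment> \<open>\<open>S\<close> and \<open>U\<close> commute, so a two-sided inverse of their product gives one of \<open>U\<close>.\<close>
      have "invertible_op U"
        unfolding invertible_op_def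
      proof (intro exI[of _ "S o\<^sub>L V"] conjI allI)
        have r: "U ((S o\<^sub>L V) x) = x" for x
          using V(3) by (simp add: US SU)
        have l: "(V o\<^sub>L S) (U x) = x" for x using V(2) by simp
        have "(S o\<^sub>L V) x = (V o\<^sub>L S) x" for x
          using l[of "(S o\<^sub>L V) x"] r[of x] by simp
        then show "(S o\<^sub>L V) (U x) = x" for x using l[of x] by simp
        show "U ((S o\<^sub>L V) x) = x" for x by (rule r)
      qed (simp add: S V bounded_op_compose)
      then show False using k(2) by (simp add: U_def in_spectrum_iff)
    qed (use e in simp)
  qed
  then show ?thesis by (simp add: closed_def)
qed

text \<open>
  A number \<open>l\<close> outside the real interval is separated from the numerical range of \<open>A\<close> by a line:
  a horizontal one if \<open>l\<close> is not real, and a vertical one otherwise. Rotating by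
  \<open>\<plusminus> \<i>\<close> or \<open>\<plusminus> 1\<close> makes \<open>A - l\<close> coercive.
\<close>

lemma spectrum_in_numerical_range:
  fixes A :: "'a::chilbert_space \<Rightarrow>\<^sub>L 'a"
  assumes A: "bounded_op A" and re: "\<And>x. cinner (A x) x \<in> \<real>"
    and lo: "\<And>x. a * (norm x)\<^sup>2 \<le> Re (cinner (A x) x)"
    and hi: "\<And>x. Re (cinner (A x) x) \<le> b * (norm x)\<^sup>2"
    and l: "l \<in> spectrum A"
  shows "l \<in> \<real>" "a \<le> Re l" "Re l \<le> b"
proof -
  have im: "Im (cinner (A x) x) = 0" for x using re[of x] by (simp add: complex_is_Real_iff)
  have *: "False" if "Im l \<noteq> 0"
  proof -
    have "l \<notin> spectrum A"
    proof (rule not_in_spectrumI[OF A, of "\<bar>Im l\<bar>" "\<i> * sgn (Im l)"])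
      show "\<bar>Im l\<bar> * (norm x)\<^sup>2 \<le>
        Re (\<i> * complex_of_real (sgn (Im l)) * (cinner (A x) x - l * of_real ((norm x)\<^sup>2)))" for x
        using im[of x] abs_sgn[of "Im l"] by (simp add: mult.assoc[symmetric] mult.commute)
    qed (use that in \<open>auto simp: sgn_if\<close>)
    then show False using l by blast
  qed
  then show "l \<in> \<real>" using complex_is_Real_iff by blast
  show "a \<le> Re l"
  proof (rule ccontr)
    assume n: "\<not> ?thesis"
    have "l \<notin> spectrum A"
      by (rule not_in_spectrumI[OF A, of "a - Re l" 1])
        (use n lo in \<open>auto simp: algebra_simps\<close>)
    then show False using l by blast
  qed
  show "Re l \<le> b"
  proof (rule ccontr)
    assume n: "\<not> ?thesis"
    have "l \<notin> spectrum A"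
      by (rule not_in_spectrumI[OF A, of "Re l - b" "-1"])
        (use n hi in \<open>auto simp: algebra_simps\<close>)
    then show False using l by blast
  qed
qed

section \<open>Polynomials of an operator\<close>

text \<open>
  Horner's scheme, as for \<^const>\<open>poly\<close>.
\<close>

definition polyop :: "('a::chilbert_space \<Rightarrow>\<^sub>L 'a) \<Rightarrow> complex poly \<Rightarrow> ('a \<Rightarrow>\<^sub>L 'a)" where
  "polyop A p = fold_coeffs (\<lambda>a T. cscale a + (A o\<^sub>L T)) p 0"

lemma polyop_0 [simp]: "polyop A 0 = 0"
  by (simp add: polyop_def)

lemma cscale_0 [simp]: "cscale 0 = 0"
  by (rule blinfun_eqI) simp

lemma polyop_pCons [simp]: "polyop A (pCons a p) = cscale a + (A o\<^sub>L polyop A p)"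
proof (cases "p = 0 \<and> a = 0")
  case True
  then show ?thesis by (auto intro!: blinfun_eqI simp: blinfun.add_left)
next
  case False
  then show ?thesis by (auto simp: polyop_def)
qed

lemma polyop_add: "polyop A (p + q) = polyop A p + polyop A q"
  by (induction p q rule: poly_induct2)
    (auto intro!: blinfun_eqI simp: blinfun.add_left blinfun.add_right scaleC_add_left)

lemma bounded_op_0 [simp]: "bounded_op 0"
  by (simp add: bounded_op_def)

context
  fixes A :: "'a::chilbert_space \<Rightarrow>\<^sub>L 'a"
  assumes A: "bounded_op A"
begin

lemma bounded_op_polyop: "bounded_op (polyop A p)"
  by (induction p) (simp_all add: bounded_op_add bounded_op_compose A)

lemma polyop_smult: "polyop A (smult c p) = cscale c o\<^sub>L polyop A p"
proof (induction p)
  case (pCons a p)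
  then show ?case
    using A by (auto intro!: blinfun_eqI
        simp: blinfun.add_left scaleC_add_right scaleC_scaleC bounded_op_def)
qed (auto intro!: blinfun_eqI)

lemma polyop_diff: "polyop A (p - q) = polyop A p - polyop A q"
proof -
  have "polyop A p = polyop A (p - q) + polyop A q"
    by (simp flip: polyop_add)
  then show ?thesis by simp
qed

lemma polyop_mult: "polyop A (p * q) = polyop A p o\<^sub>L polyop A q"
proof (induction p)
  case 0
  show ?case by (auto intro!: blinfun_eqI)
next
  case (pCons a p)
  then show ?case
    by (auto intro!: blinfun_eqI simp: mult_pCons_left polyop_add polyop_smult blinfun.add_left)
qed

lemma polyop_linear: "polyop A [:-z, 1:] = A - cscale z"
proof (rule blinfun_eqI)
  fix x :: 'a
  have "(-z) *\<^sub>C x + z *\<^sub>C x = 0"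
    by (simp flip: scaleC_add_left)
  then have "(-z) *\<^sub>C x = - (z *\<^sub>C x)"
    by (rule add_eq_0_iff2[THEN iffD1])
  then show "polyop A [:-z, 1:] x = (A - cscale z) x"
    by (simp add: blinfun.add_left blinfun.diff_left blinfun.add_right scaleC_one)
qed

text \<open>
  The easy half of the spectral mapping theorem: the polynomial splits into linear factors, and each
  factor \<open>A - z\<close> is invertible.
\<close>

lemma polyop_invertible:
  assumes "p \<noteq> 0" "\<And>z. poly p z = 0 \<Longrightarrow> z \<notin> spectrum A"
  shows "invertible_op (polyop A p)"
  using assms
proof (induction "degree p" arbitrary: p)
  case 0
  then obtain c where "p = [:c:]" "c \<noteq> 0"
    by (metis degree_eq_zeroE pCons_0_0)
  then show ?case
    by (simp add: invertible_op_cscale)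
next
  case (Suc n)
  then obtain z where z: "poly p z = 0"
    using fundamental_theorem_of_algebra[of p] by (auto simp: constant_degree)
  then obtain q where q: "p = [:-z, 1:] * q"
    by (auto simp: poly_eq_0_iff_dvd)
  with Suc.prems(1) have "q \<noteq> 0" by auto
  have "degree p = Suc (degree q)"
    unfolding q using \<open>q \<noteq> 0\<close> by (subst degree_mult_eq) auto
  then have "invertible_op (polyop A q)"
    using Suc.hyps \<open>q \<noteq> 0\<close> Suc.prems(2) by (intro Suc.hyps(1)) (auto simp: q)
  moreover have "invertible_op (A - cscale z)"
    using Suc.prems(2)[OF z] by (simp add: in_spectrum_iff)
  ultimately show ?case
    unfolding q polyop_mult polyop_linear by (rule invertible_op_compose[rotated])
qed

end

lemma adjoint_norm_le:
  fixes P Q :: "'a::chilbert_space \<Rightarrow>\<^sub>L 'a"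
  assumes "\<And>x y. cinner (P x) y = cinner x (Q y)"
  shows "norm (Q y) \<le> norm P * norm y"
proof (cases "norm (Q y) = 0")
  case False
  have "norm (Q y) * norm (Q y) = Re (cinner (Q y) (Q y))"
    by (simp add: cinner_self power2_eq_square)
  also have "\<dots> = Re (cinner (P (Q y)) y)" by (simp add: assms)
  also have "\<dots> \<le> norm (P (Q y)) * norm y"
    using complex_Re_le_cmod cinner_Cauchy_Schwarz by (rule order_trans)
  also have "\<dots> \<le> norm (Q y) * (norm P * norm y)"
    using mult_right_mono[OF norm_blinfun[of P "Q y"], of "norm y"] by (simp add: mult_ac)
  finally show ?thesis using False by simp
qed simp

text \<open>
  The vectors on which \<open>P\<close> almost attains its norm \<open>N\<close> are almost eigenvectors of \<open>P\<^sup>* P\<close> for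
  \<open>N\<^sup>2\<close>, because \<open>norm (P\<^sup>* P x - N\<^sup>2 x)\<^sup>2 \<le> N\<^sup>4 (norm x)\<^sup>2 - N\<^sup>2 (norm (P x))\<^sup>2\<close>. The
  proof runs this backwards: an inverse bounds \<open>P\<^sup>* P - N\<^sup>2\<close> from below by some \<open>d > 0\<close>, which pushes
  the norm of \<open>P\<close> below \<open>N\<close>. Here \<open>Q\<close> is the adjoint of \<open>P\<close>.
\<close>

lemma norm_square_in_spectrum:
  fixes P Q :: "'a::chilbert_space \<Rightarrow>\<^sub>L 'a"
  assumes adj: "\<And>x y. cinner (P x) y = cinner x (Q y)" and nz: "P \<noteq> 0"
  shows "\<not> invertible_op ((Q o\<^sub>L P) - cscale (of_real ((norm P)\<^sup>2)))"
proof
  define N where "N = norm P"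
  have N: "N > 0" using nz by (simp add: N_def)
  define U :: "'a \<Rightarrow>\<^sub>L 'a" where "U = (Q o\<^sub>L P) - cscale (of_real (N\<^sup>2))"
  assume "invertible_op ((Q o\<^sub>L P) - cscale (of_real ((norm P)\<^sup>2)))"
  then obtain S :: "'a \<Rightarrow>\<^sub>L 'a" where S: "\<And>x. S (U x) = x"
    unfolding U_def N_def invertible_op_def by blast
  define d where "d = 1 / (norm S + 1)"
  have d: "d > 0" by (simp add: d_def add_nonneg_pos)
  have below: "d * norm x \<le> norm (U x)" for x
  proof -
    have "norm x \<le> norm S * norm (U x)" using norm_blinfun[of S "U x"] by (simp add: S)
    also have "\<dots> \<le> (norm S + 1) * norm (U x)" by (simp add: mult_right_mono)
    finally show ?thesis
      by (simp add: d_def pos_divide_le_eq add_nonneg_pos mult.commute)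
  qed
  have key: "(norm (P x))\<^sup>2 \<le> (N\<^sup>2 - d\<^sup>2 / N\<^sup>2) * (norm x)\<^sup>2" for x
  proof -
    have "(d * norm x)\<^sup>2 \<le> (norm (U x))\<^sup>2"
      using below d by (intro power_mono) auto
    also have "(norm (U x))\<^sup>2 = (norm (Q (P x) - N\<^sup>2 *\<^sub>R x))\<^sup>2"
      by (simp add: U_def blinfun.diff_left scaleR_scaleC)
    also have "\<dots> = (norm (Q (P x)))\<^sup>2 - 2 * N\<^sup>2 * (norm (P x))\<^sup>2 + N^4 * (norm x)\<^sup>2"
    proof -
      have "cinner (Q (P x)) x = cnj (cinner x (Q (P x)))" by (rule cinner_commute)
      also have "\<dots> = cnj (cinner (P x) (P x))" by (simp add: adj)
      finally have "Re (cinner (Q (P x)) x) = (norm (P x))\<^sup>2" by (simp add: cinner_self)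
      then have "Re (cinner (Q (P x)) (N\<^sup>2 *\<^sub>R x)) = N\<^sup>2 * (norm (P x))\<^sup>2"
        unfolding scaleR_scaleC cinner_scaleC_right by simp
      then show ?thesis
        unfolding norm_diff_square by (simp add: power_mult_distrib)
    qed
    also have "(norm (Q (P x)))\<^sup>2 \<le> (N * norm (P x))\<^sup>2"
      unfolding N_def by (intro power_mono adjoint_norm_le adj) simp
    finally have "N\<^sup>2 * (norm (P x))\<^sup>2 \<le> (N^4 - d\<^sup>2) * (norm x)\<^sup>2"
      by (simp add: power_mult_distrib algebra_simps)
    then show ?thesis
      using N by (simp add: field_simps power2_eq_square power4_eq_xxxx)
  qed
  obtain x where x: "P x \<noteq> 0" using nz blinfun_eqI[of P 0] by auto
  then have "0 < (N\<^sup>2 - d\<^sup>2 / N\<^sup>2) * (norm x)\<^sup>2"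
    using key[of x] by (smt (verit) zero_less_norm_iff zero_less_power)
  then have pos: "0 \<le> N\<^sup>2 - d\<^sup>2 / N\<^sup>2"
    by (smt (verit) mult_nonpos_nonneg zero_le_power2)
  have "norm P \<le> sqrt (N\<^sup>2 - d\<^sup>2 / N\<^sup>2)"
  proof (rule norm_blinfun_bound)
    show "norm (P x) \<le> sqrt (N\<^sup>2 - d\<^sup>2 / N\<^sup>2) * norm x" for x
    proof (rule power2_le_imp_le)
      show "(norm (P x))\<^sup>2 \<le> (sqrt (N\<^sup>2 - d\<^sup>2 / N\<^sup>2) * norm x)\<^sup>2"
        unfolding power_mult_distrib real_sqrt_pow2[OF pos] by (rule key)
    qed (intro mult_nonneg_nonneg real_sqrt_ge_zero pos norm_ge_zero)
  qed (rule real_sqrt_ge_zero[OF pos])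
  then have "N\<^sup>2 \<le> (sqrt (N\<^sup>2 - d\<^sup>2 / N\<^sup>2))\<^sup>2"
    unfolding N_def by (rule power_mono) simp
  then have "N\<^sup>2 \<le> N\<^sup>2 - d\<^sup>2 / N\<^sup>2"
    unfolding real_sqrt_pow2[OF pos] .
  then show False using d N by (simp add: divide_le_0_iff)
qed

lemma polyop_adjoint:
  assumes "bounded_op A" and sym: "\<And>x y. cinner (A x) y = cinner x (A y)"
  shows "cinner (polyop A p x) y = cinner x (polyop A (map_poly cnj p) y)"
proof (induction p arbitrary: x y)
  case (pCons a p)
  have "polyop A p (A y) = A (polyop A p y)" for p y
    by (induction p) (use assms(1) in \<open>simp_all add: bounded_op_def blinfun.add_left blinfun.add_right\<close>)
  then show ?case
    using pCons
    by (simp add: map_poly_pCons blinfun.add_left cinner_add_left cinner_add_right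
        cinner_scaleC_left cinner_scaleC_right sym)
qed simp

text \<open>
  With \<open>P = p(A)\<close>, the polynomial \<open>r = \<bar>p\<bar>\<^sup>2 - (norm P)\<^sup>2\<close> takes at \<open>A\<close> a non-invertible value, so
  it vanishes somewhere on the spectrum. If \<open>r = 0\<close>, it remains to see that the spectrum is
  nonempty, which the same argument with the polynomial \<open>X\<close> shows.
\<close>

lemma norm_polyop_le:
  fixes A :: "'a::chilbert_space \<Rightarrow>\<^sub>L 'a"
  assumes A: "bounded_op A" and sym: "\<And>x y. cinner (A x) y = cinner x (A y)"
    and real: "spectrum A \<subseteq> \<real>"
    and C: "0 \<le> C" "\<And>z. z \<in> spectrum A \<Longrightarrow> cmod (poly p z) \<le> C"
  shows "norm (polyop A p) \<le> C"
proof (cases "polyop A p = 0")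
  case True
  then show ?thesis using C by simp
next
  case False
  let ?r = "\<lambda>p. map_poly cnj p * p - [:of_real ((norm (polyop A p))\<^sup>2):]"
  \<comment> \<open>The polynomial is generalized because the statement is also applied to \<open>X\<close> below.\<close>
  have root: "\<exists>z\<in>spectrum A. poly (?r p) z = 0" if "polyop A p \<noteq> 0" "?r p \<noteq> 0" for p
  proof (rule ccontr)
    assume "\<not> ?thesis"
    then have "invertible_op (polyop A (?r p))"
      using that(2) by (intro polyop_invertible A) auto
    moreover have "polyop A (?r p)
        = (polyop A (map_poly cnj p) o\<^sub>L polyop A p) - cscale (of_real ((norm (polyop A p))\<^sup>2))"
      by (auto intro!: blinfun_eqI simp: polyop_diff[OF A] polyop_mult[OF A] blinfun.diff_left blinfun.add_left)
    ultimately show False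
      using norm_square_in_spectrum[OF polyop_adjoint[OF A sym] that(1)] by simp
  qed
  have "\<exists>z\<in>spectrum A. poly (?r p) z = 0"
  proof (cases "?r p = 0")
    case True
    have "spectrum A \<noteq> {}"
    proof (cases "A = 0")
      case A0: True
      have "0 \<in> spectrum A"
      proof (rule ccontr)
        assume "0 \<notin> spectrum A"
        then have "x = 0" for x :: 'a
          by (auto simp: in_spectrum_iff invertible_op_def A0)
        then have "polyop A p = 0" by (intro blinfun_eqI) simp
        then show False using False by simp
      qed
      then show ?thesis by auto
    next
      case A0: False
      have X: "polyop A [:0, 1:] = A"
        by (rule blinfun_eqI) (simp add: blinfun.add_left blinfun.add_right scaleC_one)
      have "?r [:0, 1:] \<noteq> 0" by (simp add: map_poly_pCons)
      then show ?thesis using root[of "[:0, 1:]"] A0 X by auto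
    qed
    then show ?thesis using True by auto
  qed (use root False in blast)
  then obtain z where z: "z \<in> spectrum A" "poly (?r p) z = 0" by blast
  have "cnj z = z" using z(1) real Reals_cnj_iff by blast
  then have "cnj (poly p z) * poly p z = of_real ((norm (polyop A p))\<^sup>2)"
    using z(2) by simp
  then have "(cmod (poly p z))\<^sup>2 = (norm (polyop A p))\<^sup>2"
    by (metis complex_norm_square mult.commute of_real_eq_iff)
  then have "norm (polyop A p) = cmod (poly p z)" by simp
  then show ?thesis using C(2)[OF z(1)] by simp
qed

section \<open>The continuous functional calculus of a self-adjoint operator\<close>

lemma cinner_scaleR_right: "cinner x (r *\<^sub>R y) = of_real r * cinner x (y::'a::complex_inner)"
  by (simp add: scaleR_scaleC cinner_scaleC_right)

lemma bounded_bilinear_cinner: "bounded_bilinear (cinner :: 'a::complex_inner \<Rightarrow> 'a \<Rightarrow> complex)"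
proof
  show "\<exists>K. \<forall>a b::'a. norm (cinner a b) \<le> norm a * norm b * K"
    using cinner_Cauchy_Schwarz by (intro exI[of _ 1]) auto
qed (simp_all add: cinner_add_left cinner_add_right cinner_scaleR_left cinner_scaleR_right scaleR_conv_of_real)

lemmas tendsto_cinner = bounded_bilinear.tendsto[OF bounded_bilinear_cinner]

lemma polynomial_function_eq_poly:
  fixes g :: "real \<Rightarrow> complex"
  assumes "polynomial_function g"
  obtains p where "\<And>x. g x = poly p (of_real x)"
proof -
  have real: "\<exists>p. \<forall>x. complex_of_real (h x) = poly p (of_real x)" if hp: "real_polynomial_function h" for h :: "real \<Rightarrow> real"
  proof -
    obtain a n where h: "h = (\<lambda>x. \<Sum>i\<le>n. a i * x^i)"
      using hp unfolding real_polynomial_function_iff_sum by blast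
    show ?thesis
      by (rule exI[of _ "\<Sum>i\<le>n. monom (of_real (a i)) i"]) (simp add: h poly_sum poly_monom)
  qed
  have "real_polynomial_function (Re \<circ> g)" "real_polynomial_function (Im \<circ> g)"
    using assms bounded_linear_Re bounded_linear_Im unfolding polynomial_function_def by blast+
  from real[OF this(1)] real[OF this(2)] obtain p q
    where "\<And>x. complex_of_real (Re (g x)) = poly p (of_real x)"
      "\<And>x. complex_of_real (Im (g x)) = poly q (of_real x)"
    by auto
  then have "g x = poly (p + smult \<i> q) (of_real x)" for x
    using complex_eq[of "g x"] by simp
  then show ?thesis by (rule that)
qed

text \<open>
  On a subset of the real line polynomials in the one complex variable \<open>z\<close> suffice; on other
  compact sets \<open>cnj z\<close> would be needed as well.
\<close>

lemma polynomial_approximation_on_reals: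
  fixes f :: "complex \<Rightarrow> complex"
  assumes "compact S" "S \<subseteq> \<real>" "continuous_on S f"
  obtains p where "uniform_limit S (\<lambda>n. poly (p n)) f sequentially"
proof -
  have S: "z = of_real (Re z)" if "z \<in> S" for z
    using that assms(2) by (metis of_real_Re subsetD)
  have cpt: "compact (Re ` S)"
    by (intro compact_continuous_image continuous_intros assms)
  have cont: "continuous_on (Re ` S) (\<lambda>x. f (of_real x))"
  proof (rule continuous_on_compose2[OF assms(3)])
    show "of_real ` Re ` S \<subseteq> S" using S by auto
  qed (intro continuous_intros)
  obtain g where g: "uniform_limit (Re ` S) g (\<lambda>x. f (of_real x)) sequentially"
    "\<And>n. polynomial_function (g n)"
    using Stone_Weierstrass_uniform_limit[OF cpt cont] by blast
  have "\<exists>p. \<forall>x. g n x = poly p (of_real x)" for n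
    using polynomial_function_eq_poly[OF g(2)[of n]] by metis
  then obtain p where p: "\<And>n x. g n x = poly (p n) (of_real x)"
    by metis
  have "uniform_limit S (\<lambda>n z. g n (Re z)) (\<lambda>z. f (of_real (Re z))) sequentially"
    using g(1) unfolding uniform_limit_iff by auto
  then have "uniform_limit S (\<lambda>n. poly (p n)) f sequentially"
    by (rule uniform_limit_cong'[THEN iffD1, rotated -1]) (metis p S)+
  then show ?thesis by (rule that)
qed

definition self_adjoint_op :: "('a::chilbert_space \<Rightarrow>\<^sub>L 'a) \<Rightarrow> bool" where
  "self_adjoint_op A \<longleftrightarrow> bounded_op A \<and> (\<forall>x y. cinner (A x) y = cinner x (A y))"

lemma self_adjoint_opD:
  assumes "self_adjoint_op A"
  shows "bounded_op A" "cinner (A x) y = cinner x (A y)"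
  using assms by (auto simp: self_adjoint_op_def)

lemma self_adjoint_cinner_real: "self_adjoint_op A \<Longrightarrow> cinner (A x) x \<in> \<real>"
  by (metis Reals_cnj_iff cinner_commute self_adjoint_opD(2))

lemma
  fixes A :: "'a::chilbert_space \<Rightarrow>\<^sub>L 'a"
  assumes A: "self_adjoint_op A"
  shows spectrum_self_adjoint_real: "spectrum A \<subseteq> \<real>"
    and compact_spectrum_self_adjoint: "compact (spectrum A)"
proof -
  have b: "\<bar>Re (cinner (A x) x)\<bar> \<le> norm A * (norm x)\<^sup>2" for x
  proof -
    have "\<bar>Re (cinner (A x) x)\<bar> \<le> norm (A x) * norm x"
      using abs_Re_le_cmod cinner_Cauchy_Schwarz by (rule order_trans)
    also have "\<dots> \<le> norm A * norm x * norm x"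
      by (intro mult_right_mono norm_blinfun) simp
    finally show ?thesis by (simp add: power2_eq_square mult.assoc)
  qed
  have lo: "- norm A * (norm x)\<^sup>2 \<le> Re (cinner (A x) x)"
    and hi: "Re (cinner (A x) x) \<le> norm A * (norm x)\<^sup>2" for x
    using b[of x] by auto
  note rng = spectrum_in_numerical_range[OF self_adjoint_opD(1)[OF A] self_adjoint_cinner_real[OF A] lo hi]
  show real: "spectrum A \<subseteq> \<real>" using rng by blast
  have "cmod l \<le> norm A" if "l \<in> spectrum A" for l
    using rng[OF that] by (auto simp: Reals_def)
  then have "bounded (spectrum A)" by (auto simp: bounded_iff)
  then show "compact (spectrum A)"
    using closed_spectrum[OF self_adjoint_opD(1)[OF A]] by (simp add: compact_eq_bounded_closed)
qed

text \<open>
  Read \<open>f(A) = T\<close>. A relation is used so that the calculation rules follow from limit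
  theorems, before \<open>T\<close> is known to exist and to be unique.
\<close>

definition polyop_limit ::
  "('a::chilbert_space \<Rightarrow>\<^sub>L 'a) \<Rightarrow> (complex \<Rightarrow> complex) \<Rightarrow> ('a \<Rightarrow>\<^sub>L 'a) \<Rightarrow> bool" where
  "polyop_limit A f T \<longleftrightarrow> (\<exists>p. uniform_limit (spectrum A) (\<lambda>n. poly (p n)) f sequentially \<and>
     (\<lambda>n. polyop A (p n)) \<longlonglongrightarrow> T)"

lemma poly_fun_simps:
  "poly (p + q) = (\<lambda>z. poly p z + poly q z)"
  "poly (p - q) = (\<lambda>z. poly p z - poly q z)"
  "poly (p * q) = (\<lambda>z. poly p z * poly q z)"
  "poly (smult c p) = (\<lambda>z. c * poly p z)"
  "poly (pCons c p) = (\<lambda>z. c + z * poly p z)"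
  for p q :: "'a::comm_ring poly"
  by (simp_all add: fun_eq_iff)

lemma polyop_limit_poly: "polyop_limit A (poly p) (polyop A p)"
  unfolding polyop_limit_def by (intro exI[of _ "\<lambda>_. p"]) (auto simp: uniform_limit_iff)

lemma tendsto_blinfun_compose: "S \<longlonglongrightarrow> T \<Longrightarrow> U \<longlonglongrightarrow> V \<Longrightarrow> (\<lambda>n. S n o\<^sub>L U n) \<longlonglongrightarrow> (T o\<^sub>L V)"
  by (rule bounded_bilinear.tendsto[OF bounded_bilinear_blinfun_compose])

lemma tendsto_blinfun_app: "S \<longlonglongrightarrow> T \<Longrightarrow> (\<lambda>n. blinfun_apply (S n) x) \<longlonglongrightarrow> T x"
  by (intro tendsto_intros)

context
  fixes A :: "'a::chilbert_space \<Rightarrow>\<^sub>L 'a"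
  assumes A: "self_adjoint_op A"
begin

lemma polyop_limit_norm_le:
  assumes "polyop_limit A f T" "0 \<le> C" "\<And>z. z \<in> spectrum A \<Longrightarrow> cmod (f z) \<le> C"
  shows "norm T \<le> C"
proof (rule field_le_epsilon)
  fix e :: real assume e: "e > 0"
  obtain p where p: "uniform_limit (spectrum A) (\<lambda>n. poly (p n)) f sequentially"
    "(\<lambda>n. polyop A (p n)) \<longlonglongrightarrow> T"
    using assms(1) by (auto simp: polyop_limit_def)
  from p(1) e have "\<forall>\<^sub>F n in sequentially. \<forall>z\<in>spectrum A. dist (poly (p n) z) (f z) < e"
    by (auto simp: uniform_limit_iff)
  then have "\<forall>\<^sub>F n in sequentially. norm (polyop A (p n)) \<le> C + e"
  proof eventually_elim
    case (elim n)
    show ?case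
    proof (rule norm_polyop_le[OF self_adjoint_opD[OF A] spectrum_self_adjoint_real[OF A]])
      fix z assume z: "z \<in> spectrum A"
      show "cmod (poly (p n) z) \<le> C + e"
        using elim[rule_format, OF z] assms(3)[OF z] norm_triangle_ineq2[of "poly (p n) z" "f z"]
        by (simp add: dist_norm)
    qed (use assms(2) e in simp)
  qed
  then show "norm T \<le> C + e"
    using tendsto_norm[OF p(2)] by (intro tendsto_upperbound[of _ _ sequentially]) auto
qed

lemma polyop_limit_diff:
  assumes "polyop_limit A f T" "polyop_limit A g U"
  shows "polyop_limit A (\<lambda>z. f z - g z) (T - U)"
proof -
  obtain p q where "uniform_limit (spectrum A) (\<lambda>n. poly (p n)) f sequentially"
    "(\<lambda>n. polyop A (p n)) \<longlonglongrightarrow> T" "uniform_limit (spectrum A) (\<lambda>n. poly (q n)) g sequentially"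
    "(\<lambda>n. polyop A (q n)) \<longlonglongrightarrow> U"
    using assms by (auto simp: polyop_limit_def)
  then show ?thesis
    unfolding polyop_limit_def
    by (intro exI[of _ "\<lambda>n. p n - q n"])
      (simp add: poly_fun_simps polyop_diff[OF self_adjoint_opD(1)[OF A]] uniform_limit_minus tendsto_diff)
qed

lemma polyop_limit_unique:
  assumes "polyop_limit A f T" "polyop_limit A f U" shows "T = U"
  using polyop_limit_norm_le[OF polyop_limit_diff[OF assms], of 0] by simp

lemma polyop_limit_add:
  assumes "polyop_limit A f T" "polyop_limit A g U"
  shows "polyop_limit A (\<lambda>z. f z + g z) (T + U)"
proof -
  obtain p q where "uniform_limit (spectrum A) (\<lambda>n. poly (p n)) f sequentially"
    "(\<lambda>n. polyop A (p n)) \<longlonglongrightarrow> T" "uniform_limit (spectrum A) (\<lambda>n. poly (q n)) g sequentially"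
    "(\<lambda>n. polyop A (q n)) \<longlonglongrightarrow> U"
    using assms by (auto simp: polyop_limit_def)
  then show ?thesis
    unfolding polyop_limit_def
    by (intro exI[of _ "\<lambda>n. p n + q n"]) (simp add: poly_fun_simps polyop_add uniform_limit_add tendsto_add)
qed

lemma polyop_limit_mult:
  assumes "polyop_limit A f T" "polyop_limit A g U"
    and "continuous_on (spectrum A) f" "continuous_on (spectrum A) g"
  shows "polyop_limit A (\<lambda>z. f z * g z) (T o\<^sub>L U)"
proof -
  have "bounded (f ` spectrum A)" "bounded (g ` spectrum A)"
    using assms(3,4) compact_continuous_image compact_imp_bounded compact_spectrum_self_adjoint[OF A]
    by blast+
  moreover obtain p q where "uniform_limit (spectrum A) (\<lambda>n. poly (p n)) f sequentially"
    "(\<lambda>n. polyop A (p n)) \<longlonglongrightarrow> T" "uniform_limit (spectrum A) (\<lambda>n. poly (q n)) g sequentially"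
    "(\<lambda>n. polyop A (q n)) \<longlonglongrightarrow> U"
    using assms(1,2) by (auto simp: polyop_limit_def)
  ultimately show ?thesis
    unfolding polyop_limit_def
    by (intro exI[of _ "\<lambda>n. p n * q n"])
      (simp add: poly_fun_simps polyop_mult[OF self_adjoint_opD(1)[OF A]] uniform_lim_mult tendsto_blinfun_compose)
qed

lemma polyop_limit_scale:
  assumes "polyop_limit A f T"
  shows "polyop_limit A (\<lambda>z. c * f z) (cscale c o\<^sub>L T)"
proof -
  obtain p where "uniform_limit (spectrum A) (\<lambda>n. poly (p n)) f sequentially"
    "(\<lambda>n. polyop A (p n)) \<longlonglongrightarrow> T"
    using assms by (auto simp: polyop_limit_def)
  then show ?thesis
    unfolding polyop_limit_def
    by (intro exI[of _ "\<lambda>n. smult c (p n)"])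
      (simp add: poly_fun_simps polyop_smult[OF self_adjoint_opD(1)[OF A]] tendsto_blinfun_compose
        bounded_linear.uniform_limit[OF bounded_linear_mult_right])
qed

lemma polyop_limit_bounded_op:
  assumes "polyop_limit A f T" shows "bounded_op T"
  unfolding bounded_op_def
proof (intro allI)
  fix c x
  obtain p where p: "(\<lambda>n. polyop A (p n)) \<longlonglongrightarrow> T"
    using assms by (auto simp: polyop_limit_def)
  have "(\<lambda>n. cscale c (polyop A (p n) x)) \<longlonglongrightarrow> cscale c (T x)"
    by (intro blinfun.tendsto tendsto_const tendsto_blinfun_app p)
  moreover have "cscale c (polyop A (p n) x) = polyop A (p n) (c *\<^sub>C x)" for n
    using bounded_op_polyop[OF self_adjoint_opD(1)[OF A]] by (simp add: bounded_op_def)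
  ultimately have "(\<lambda>n. polyop A (p n) (c *\<^sub>C x)) \<longlonglongrightarrow> c *\<^sub>C T x"
    by simp
  then show "T (c *\<^sub>C x) = c *\<^sub>C T x"
    by (rule LIMSEQ_unique[OF tendsto_blinfun_app[OF p]])
qed

lemma polyop_limit_adjoint:
  assumes "polyop_limit A f T" "polyop_limit A (\<lambda>z. cnj (f z)) U"
  shows "cinner (T x) y = cinner x (U y)"
proof -
  obtain p where p: "uniform_limit (spectrum A) (\<lambda>n. poly (p n)) f sequentially"
    "(\<lambda>n. polyop A (p n)) \<longlonglongrightarrow> T"
    using assms(1) by (auto simp: polyop_limit_def)
  obtain q where q: "uniform_limit (spectrum A) (\<lambda>n. poly (q n)) (\<lambda>z. cnj (f z)) sequentially"
    "(\<lambda>n. polyop A (q n)) \<longlonglongrightarrow> U"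
    using assms(2) by (auto simp: polyop_limit_def)
  have cnj: "cnj z = z" if "z \<in> spectrum A" for z
    using that spectrum_self_adjoint_real[OF A] Reals_cnj_iff by blast
  \<comment> \<open>The conjugates of the \<open>q n\<close> also approximate \<open>f\<close>, and their operators are the adjoints.\<close>
  have "uniform_limit (spectrum A) (\<lambda>n z. cnj (poly (q n) z)) f sequentially"
    using bounded_linear.uniform_limit[OF bounded_linear_cnj q(1)] by simp
  then have "uniform_limit (spectrum A) (\<lambda>n. poly (map_poly cnj (q n))) f sequentially"
    by (rule uniform_limit_cong'[THEN iffD1, rotated -1]) (simp_all add: cnj)
  then have lim0: "uniform_limit (spectrum A) (\<lambda>n z. poly (p n) z - poly (map_poly cnj (q n)) z)
    (\<lambda>z. f z - f z) sequentially"
    by (intro uniform_limit_minus p(1))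
  have "(\<lambda>n. polyop A (p n) - polyop A (map_poly cnj (q n))) \<longlonglongrightarrow> 0"
  proof (rule tendstoI)
    fix e :: real assume e: "e > 0"
    then have "\<forall>\<^sub>F n in sequentially. \<forall>z\<in>spectrum A.
        dist (poly (p n) z - poly (map_poly cnj (q n)) z) (f z - f z) < e / 2"
      using lim0 by (intro uniform_limitD) simp_all
    then show "\<forall>\<^sub>F n in sequentially. dist (polyop A (p n) - polyop A (map_poly cnj (q n))) 0 < e"
    proof eventually_elim
      case (elim n)
      have "norm (polyop A (p n - map_poly cnj (q n))) \<le> e / 2"
        using elim e
        by (intro norm_polyop_le[OF self_adjoint_opD[OF A] spectrum_self_adjoint_real[OF A]])
          (auto simp del: poly_map_poly_cnj intro: less_imp_le)
      then show ?case
        using e by (simp add: polyop_diff[OF self_adjoint_opD(1)[OF A]])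
    qed
  qed
  then have "(\<lambda>n. polyop A (p n) - (polyop A (p n) - polyop A (map_poly cnj (q n)))) \<longlonglongrightarrow> T - 0"
    by (intro tendsto_diff p(2))
  then have "(\<lambda>n. polyop A (map_poly cnj (q n))) \<longlonglongrightarrow> T" by simp
  then have "(\<lambda>n. cinner (polyop A (map_poly cnj (q n)) x) y) \<longlonglongrightarrow> cinner (T x) y"
    by (intro tendsto_cinner tendsto_blinfun_app tendsto_const)
  moreover have "cinner (polyop A (map_poly cnj (q n)) x) y = cinner x (polyop A (q n) y)" for n
    by (simp add: polyop_adjoint[OF self_adjoint_opD[OF A]] map_poly_map_poly o_def)
  moreover have "(\<lambda>n. cinner x (polyop A (q n) y)) \<longlonglongrightarrow> cinner x (U y)"
    by (intro tendsto_cinner tendsto_blinfun_app tendsto_const q(2))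
  ultimately show ?thesis
    using LIMSEQ_unique by auto
qed

text \<open>
  By \<open>norm_polyop_le\<close>, uniform convergence on the spectrum makes the operators a Cauchy sequence.
\<close>

lemma polyop_limit_exists:
  assumes "continuous_on (spectrum A) f"
  shows "\<exists>T. polyop_limit A f T"
proof -
  obtain p where p: "uniform_limit (spectrum A) (\<lambda>n. poly (p n)) f sequentially"
    using polynomial_approximation_on_reals[OF compact_spectrum_self_adjoint[OF A]
        spectrum_self_adjoint_real[OF A] assms] .
  have "Cauchy (\<lambda>n. polyop A (p n))"
  proof (rule metric_CauchyI)
    fix e :: real assume e: "e > 0"
    have "\<forall>\<^sub>F n in sequentially. \<forall>z\<in>spectrum A. dist (poly (p n) z) (f z) < e / 4"
      using p e by (intro uniform_limitD) simp_all
    then obtain N where N: "\<And>n z. n \<ge> N \<Longrightarrow> z \<in> spectrum A \<Longrightarrow> dist (poly (p n) z) (f z) < e / 4"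
      by (auto simp: eventually_sequentially)
    show "\<exists>N. \<forall>m\<ge>N. \<forall>n\<ge>N. dist (polyop A (p m)) (polyop A (p n)) < e"
    proof (intro exI[of _ N] allI impI)
      fix m n assume mn: "m \<ge> N" "n \<ge> N"
      have "norm (polyop A (p m - p n)) \<le> e / 2"
      proof (rule norm_polyop_le[OF self_adjoint_opD[OF A] spectrum_self_adjoint_real[OF A]])
        fix z assume z: "z \<in> spectrum A"
        show "cmod (poly (p m - p n) z) \<le> e / 2"
          using N[OF mn(1) z] N[OF mn(2) z] dist_triangle2[of "poly (p m) z" "poly (p n) z" "f z"]
          by (simp add: dist_norm)
      qed (use e in simp)
      then show "dist (polyop A (p m)) (polyop A (p n)) < e"
        using e by (simp add: dist_norm polyop_diff[OF self_adjoint_opD(1)[OF A]])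
    qed
  qed
  then obtain T where "(\<lambda>n. polyop A (p n)) \<longlonglongrightarrow> T"
    using Cauchy_convergent convergent_def by blast
  then show ?thesis using p by (auto simp: polyop_limit_def)
qed

theorem is_cfc_cfc: "is_cfc A (cfc A)"
proof -
  define \<Phi> where "\<Phi> f = (SOME T. polyop_limit A f T)" for f
  have \<Phi>: "polyop_limit A f (\<Phi> f)" if "continuous_on (spectrum A) f" for f
    unfolding \<Phi>_def by (rule someI_ex[OF polyop_limit_exists[OF that]])
  have eq: "\<Phi> f = T" if "polyop_limit A f T" for f T
    unfolding \<Phi>_def by (rule some_equality, rule that) (rule polyop_limit_unique[OF _ that])
  have "is_cfc A \<Phi>"
    unfolding is_cfc_def
  proof (intro conjI allI impI)
    have "polyop A [:1:] = id_blinfun"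
      by (rule blinfun_eqI) (simp add: scaleC_one)
    then show "\<Phi> (\<lambda>z. 1) = id_blinfun"
      using polyop_limit_poly[of A "[:1:]"] by (intro eq) (simp add: poly_fun_simps(5) del: polyop_pCons)
    have "polyop A [:0, 1:] = A"
      by (rule blinfun_eqI) (simp add: blinfun.add_left blinfun.add_right scaleC_one)
    then show "\<Phi> (\<lambda>z. z) = A"
      using polyop_limit_poly[of A "[:0, 1:]"] by (intro eq) (simp add: poly_fun_simps(5) del: polyop_pCons)
  next
    fix f :: "complex \<Rightarrow> complex" assume f: "continuous_on (spectrum A) f"
    show "bounded_op (\<Phi> f)" by (rule polyop_limit_bounded_op[OF \<Phi>[OF f]])
    show "\<Phi> (\<lambda>z. c * f z) x = c *\<^sub>C \<Phi> f x" for c x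
      by (simp add: eq[OF polyop_limit_scale[OF \<Phi>[OF f]]])
    show "cinner (\<Phi> f x) y = cinner x (\<Phi> (\<lambda>z. cnj (f z)) y)" for x y
      by (intro polyop_limit_adjoint[of f] \<Phi> continuous_intros f)
    show "norm (\<Phi> f) \<le> C" if "0 \<le> C" "\<forall>z\<in>spectrum A. cmod (f z) \<le> C" for C
      using polyop_limit_norm_le[OF \<Phi>[OF f]] that by blast
  next
    fix f g :: "complex \<Rightarrow> complex" assume fg: "continuous_on (spectrum A) f" "continuous_on (spectrum A) g"
    show "\<Phi> (\<lambda>z. f z + g z) = \<Phi> f + \<Phi> g"
      by (intro eq polyop_limit_add \<Phi> fg)
    show "\<Phi> (\<lambda>z. f z * g z) = \<Phi> f o\<^sub>L \<Phi> g"
      by (intro eq polyop_limit_mult \<Phi> fg)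
  qed
  then show ?thesis
    unfolding cfc_def by (rule someI[of "is_cfc A"])
qed

end

section \<open>Order and the functional calculus\<close>

text \<open>
  Polarization: the form is real at \<open>x + y\<close> and at \<open>\<i> x + y\<close>. This uses complex scalars
  and fails for real-linear maps.
\<close>

lemma positive_op_imp_self_adjoint:
  assumes "positive_op A" shows "self_adjoint_op A"
proof -
  have A: "bounded_op A" and re: "\<And>x. Im (cinner (A x) x) = 0"
    using assms by (auto simp: positive_op_def complex_is_Real_iff)
  have "cinner (A x) y = cinner x (A y)" for x y
  proof -
    have "Im (cinner (A x) y + cinner (A y) x) = 0"
      using re[of "x + y"] re[of x] re[of y]
      by (simp add: blinfun.add_right cinner_add_left cinner_add_right)
    moreover have "Re (cinner (A x) y - cinner (A y) x) = 0"
      using re[of "\<i> *\<^sub>C x + y"] re[of x] re[of y] A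
      by (simp add: blinfun.add_right cinner_add_left cinner_add_right bounded_op_def
          cinner_scaleC_left cinner_scaleC_right)
    ultimately have "cinner (A x) y = cnj (cinner (A y) x)"
      by (simp add: complex_eq_iff)
    then show ?thesis by (metis cinner_commute)
  qed
  with A show ?thesis by (simp add: self_adjoint_op_def)
qed

lemma self_adjoint_op_diff: "self_adjoint_op A \<Longrightarrow> self_adjoint_op B \<Longrightarrow> self_adjoint_op (A - B)"
  by (simp add: self_adjoint_op_def bounded_op_diff blinfun.diff_left cinner_diff_left cinner_diff_right)

lemma self_adjoint_op_scaleR: "self_adjoint_op A \<Longrightarrow> self_adjoint_op (r *\<^sub>R A)"
  by (simp add: self_adjoint_op_def bounded_op_scaleR blinfun.scaleR_left cinner_scaleR_left cinner_scaleR_right)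

lemma op_le_iff_self_adjoint:
  assumes "self_adjoint_op A" "self_adjoint_op B"
  shows "A \<preceq> B \<longleftrightarrow> (\<forall>x. Re (cinner (A x) x) \<le> Re (cinner (B x) x))"
  using self_adjoint_opD(1)[OF self_adjoint_op_diff[OF assms(2,1)]]
    self_adjoint_cinner_real[OF self_adjoint_op_diff[OF assms(2,1)]]
  by (simp add: op_le_def positive_op_def blinfun.diff_left cinner_diff_left)

lemma op_leD: "A \<preceq> B \<Longrightarrow> Re (cinner (A x) x) \<le> Re (cinner (B x) x)"
  by (auto simp: op_le_def positive_op_def blinfun.diff_left cinner_diff_left)

lemma cfcD:
  assumes "self_adjoint_op A" "continuous_on (spectrum A) f"
  shows "bounded_op (cfc A f)"
    and "cfc A (\<lambda>z. c * f z) x = c *\<^sub>C cfc A f x"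
    and "cinner (cfc A f x) y = cinner x (cfc A (\<lambda>z. cnj (f z)) y)"
    and "0 \<le> C \<Longrightarrow> (\<And>z. z \<in> spectrum A \<Longrightarrow> cmod (f z) \<le> C) \<Longrightarrow> norm (cfc A f) \<le> C"
    and "continuous_on (spectrum A) g \<Longrightarrow> cfc A (\<lambda>z. f z + g z) = cfc A f + cfc A g"
    and "continuous_on (spectrum A) g \<Longrightarrow> cfc A (\<lambda>z. f z * g z) = cfc A f o\<^sub>L cfc A g"
  using is_cfc_cfc[OF assms(1)] assms(2) unfolding is_cfc_def by blast+

lemma cfc_norm_diff_le:
  assumes A: "self_adjoint_op A" and f: "continuous_on (spectrum A) f" and g: "continuous_on (spectrum A) g"
    and C: "0 \<le> C" "\<And>z. z \<in> spectrum A \<Longrightarrow> cmod (f z - g z) \<le> C"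
  shows "norm (cfc A f - cfc A g) \<le> C"
proof -
  have g': "continuous_on (spectrum A) (\<lambda>z. (-1) * g z)" by (intro continuous_intros g)
  have "cfc A (\<lambda>z. (-1) * g z) = - cfc A g"
    by (rule blinfun_eqI) (simp only: cfcD(2)[OF A g] scaleC_minus_one blinfun.minus_left)
  then have "cfc A f - cfc A g = cfc A (\<lambda>z. f z + (-1) * g z)"
    using cfcD(5)[OF A f g'] by simp
  moreover have "norm (cfc A (\<lambda>z. f z + (-1) * g z)) \<le> C"
    using C by (intro cfcD(4)[OF A] continuous_on_add f g') simp_all
  ultimately show ?thesis by simp
qed

lemma cfc_cong:
  assumes "self_adjoint_op A" "continuous_on (spectrum A) f" "continuous_on (spectrum A) g"
    and "\<And>z. z \<in> spectrum A \<Longrightarrow> f z = g z"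
  shows "cfc A f = cfc A g"
  using cfc_norm_diff_le[OF assms(1-3), of 0] assms(4) by simp

section \<open>Real powers\<close>

text \<open>
  For \<open>a > 0\<close> all real powers are continuous on the spectrum, so negative exponents are available
  too; this is what makes the powers below a one-parameter group.
\<close>

definition spectrum_between :: "real \<Rightarrow> real \<Rightarrow> ('a::chilbert_space \<Rightarrow>\<^sub>L 'a) \<Rightarrow> bool" where
  "spectrum_between a b A \<longleftrightarrow> self_adjoint_op A \<and> (\<forall>z\<in>spectrum A. a \<le> Re z \<and> Re z \<le> b)"

lemma spectrum_betweenI:
  assumes A: "self_adjoint_op A"
    and "\<And>x. a * (norm x)\<^sup>2 \<le> Re (cinner (A x) x)" "\<And>x. Re (cinner (A x) x) \<le> b * (norm x)\<^sup>2"
  shows "spectrum_between a b A"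
  using spectrum_in_numerical_range[OF self_adjoint_opD(1)[OF A] self_adjoint_cinner_real[OF A] assms(2,3)] A
  by (simp add: spectrum_between_def)

context
  fixes A :: "'a::chilbert_space \<Rightarrow>\<^sub>L 'a" and a b :: real
  assumes A: "spectrum_between a b A" and a: "0 < a"
begin

lemma spectrum_between_self_adjoint: "self_adjoint_op A"
  using A by (simp add: spectrum_between_def)

lemma spectrum_between_bounds: "z \<in> spectrum A \<Longrightarrow> a \<le> Re z" "z \<in> spectrum A \<Longrightarrow> Re z \<le> b"
  using A by (auto simp: spectrum_between_def)

lemma spectrum_between_Re_nonzero: "z \<in> spectrum A \<Longrightarrow> Re z \<noteq> 0"
  using spectrum_between_bounds(1)[of z] a by auto

lemma continuous_on_powr_spectrum:
  "continuous_on (spectrum A) (\<lambda>z. complex_of_real (Re z powr r))"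
  using spectrum_between_Re_nonzero by (intro continuous_intros) auto

lemma op_powr_self_adjoint: "self_adjoint_op (op_powr A r)"
  using cfcD(1,3)[OF spectrum_between_self_adjoint continuous_on_powr_spectrum, of r]
  unfolding self_adjoint_op_def op_powr_def complex_cnj_complex_of_real by blast

lemma op_powr_sym: "cinner (op_powr A r x) y = cinner x (op_powr A r y)"
  by (rule self_adjoint_opD(2)[OF op_powr_self_adjoint])

lemma op_powr_powr: "op_powr A r (op_powr A t x) = op_powr A (r + t) x"
  using cfcD(6)[OF spectrum_between_self_adjoint continuous_on_powr_spectrum continuous_on_powr_spectrum, of r t]
  unfolding op_powr_def powr_add of_real_mult by simp

lemma op_powr_zero: "op_powr A 0 x = x"
proof -
  have "cfc A (\<lambda>z. complex_of_real (Re z powr 0)) = cfc A (\<lambda>z. 1)"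
    using spectrum_between_Re_nonzero by (intro cfc_cong[OF spectrum_between_self_adjoint continuous_on_powr_spectrum continuous_on_const]) auto
  then show ?thesis
    using is_cfc_cfc[OF spectrum_between_self_adjoint] by (simp add: op_powr_def is_cfc_def)
qed

lemma op_powr_one: "op_powr A 1 x = A x"
proof -
  have "cfc A (\<lambda>z. complex_of_real (Re z powr 1)) = cfc A (\<lambda>z. z)"
  proof (rule cfc_cong[OF spectrum_between_self_adjoint continuous_on_powr_spectrum continuous_on_id])
    fix z assume z: "z \<in> spectrum A"
    then have "z = of_real (Re z)"
      using spectrum_self_adjoint_real[OF spectrum_between_self_adjoint] by (metis of_real_Re subsetD)
    then show "complex_of_real (Re z powr 1) = z" using spectrum_between_bounds(1)[OF z] a by simp
  qed
  then show ?thesis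
    using is_cfc_cfc[OF spectrum_between_self_adjoint] by (simp add: op_powr_def is_cfc_def)
qed

lemma op_powr_inverse: "op_powr A (- r) (op_powr A r x) = x" "op_powr A r (op_powr A (- r) x) = x"
  by (simp_all add: op_powr_powr op_powr_zero)

lemma norm_op_powr_half: "(norm (op_powr A (r / 2) x))\<^sup>2 = Re (cinner (op_powr A r x) x)"
proof -
  have "Re (cinner (op_powr A (r / 2) x) (op_powr A (r / 2) x))
      = Re (cinner (op_powr A (r / 2) (op_powr A (r / 2) x)) x)"
    by (simp only: op_powr_sym)
  then show ?thesis by (simp add: op_powr_powr cinner_self)
qed

lemma norm_op_powr_le:
  assumes "0 \<le> C" "\<And>t. a \<le> t \<Longrightarrow> t \<le> b \<Longrightarrow> t powr r \<le> C"
  shows "norm (op_powr A r) \<le> C"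
  unfolding op_powr_def
  using assms spectrum_between_bounds by (intro cfcD(4)[OF spectrum_between_self_adjoint continuous_on_powr_spectrum]) auto

text \<open>
  Contractivity of the calculus reduces norm continuity in the exponent to the uniform continuity of
  \<open>(r, t) \<mapsto> t powr r\<close> on the compact rectangle \<open>[0, 1] \<times> [a, b]\<close>.
\<close>

lemma continuous_on_op_powr: "continuous_on {0..1} (op_powr A)"
proof -
  define g where "g = (\<lambda>(q, t). t powr q :: real)"
  have "continuous_on ({0..1} \<times> {a..b}) g"
    unfolding g_def case_prod_beta using a by (intro continuous_intros) auto
  then have uc: "uniformly_continuous_on ({0..1} \<times> {a..b}) g"
    by (intro compact_uniformly_continuous compact_Times) auto
  have "uniformly_continuous_on {0..1} (op_powr A)"
    unfolding uniformly_continuous_on_def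
  proof (intro allI impI)
    fix e :: real assume e: "e > 0"
    then obtain d where d: "d > 0"
      "\<And>u v. u \<in> {0..1} \<times> {a..b} \<Longrightarrow> v \<in> {0..1} \<times> {a..b} \<Longrightarrow> dist v u < d \<Longrightarrow> dist (g v) (g u) < e / 2"
      using uc unfolding uniformly_continuous_on_def by (metis half_gt_zero)
    have "dist (op_powr A r) (op_powr A q) < e" if "q \<in> {0..1}" "r \<in> {0..1}" "dist r q < d" for q r
    proof -
      have "norm (op_powr A r - op_powr A q) \<le> e / 2"
        unfolding op_powr_def
      proof (rule cfc_norm_diff_le[OF spectrum_between_self_adjoint continuous_on_powr_spectrum continuous_on_powr_spectrum])
        fix z assume z: "z \<in> spectrum A"
        have "dist (g (r, Re z)) (g (q, Re z)) < e / 2"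
          using that spectrum_between_bounds[OF z] by (intro d(2)) (auto simp: dist_Pair_Pair)
        then show "cmod (complex_of_real (Re z powr r) - complex_of_real (Re z powr q)) \<le> e / 2"
          by (simp add: g_def dist_norm flip: of_real_diff)
      qed (use e in simp)
      then show ?thesis using e by (simp add: dist_norm)
    qed
    then show "\<exists>d>0. \<forall>x\<in>{0..1}. \<forall>x'\<in>{0..1}. dist x' x < d \<longrightarrow> dist (op_powr A x') (op_powr A x) < e"
      using d(1) by blast
  qed
  then show ?thesis by (rule uniformly_continuous_imp_continuous)
qed

lemma continuous_on_op_powr_form: "continuous_on {0..1} (\<lambda>r. Re (cinner (op_powr A r x) x))"
  by (intro continuous_intros bounded_bilinear.continuous_on[OF bounded_bilinear_cinner]
      bounded_bilinear.continuous_on[OF bounded_bilinear_blinfun_apply] continuous_on_op_powr)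

end

section \<open>The Loewner--Heinz inequality\<close>

text \<open>
  The sequence \<open>n \<mapsto> norm (T\<^sup>n x)\<close> is logarithmically convex by Cauchy--Schwarz. If its first step were
  an increase, it would grow at least geometrically. This replaces the equality of norm and spectral
  radius.
\<close>

lemma self_adjoint_power_bounded_imp_contraction:
  assumes T: "self_adjoint_op T" and K: "\<And>n. norm ((blinfun_apply T ^^ n) x) \<le> K"
  shows "norm (T x) \<le> norm x"
proof (rule ccontr)
  assume less: "\<not> ?thesis"
  define u where "u n = norm ((blinfun_apply T ^^ n) x)" for n
  have u0: "u 0 > 0" using less by (auto simp: u_def)
  define r where "r = u 1 / u 0"
  have r: "r > 1" using less u0 by (simp add: r_def u_def)
  have conv: "(u (Suc n))\<^sup>2 \<le> u n * u (Suc (Suc n))" for n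
  proof -
    let ?y = "(blinfun_apply T ^^ n) x"
    have "(u (Suc n))\<^sup>2 = Re (cinner (T ?y) (T ?y))" by (simp add: u_def cinner_self)
    also have "\<dots> = Re (cinner ?y (T (T ?y)))" by (simp add: self_adjoint_opD(2)[OF T])
    also have "\<dots> \<le> norm ?y * norm (T (T ?y))"
      using complex_Re_le_cmod cinner_Cauchy_Schwarz by (rule order_trans)
    finally show ?thesis by (simp add: u_def)
  qed
  have step: "0 < u n \<and> r * u n \<le> u (Suc n)" for n
  proof (induction n)
    case 0
    show ?case using u0 by (simp add: r_def)
  next
    case (Suc n)
    then have pos: "0 < u (Suc n)"
      using r by (smt (verit) mult_pos_pos)
    have "u n * (r * u (Suc n)) \<le> u (Suc n) * u (Suc n)"
      using Suc pos by (simp add: mult.assoc[symmetric] mult.commute[of "u n" r] mult_right_mono)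
    also have "\<dots> \<le> u n * u (Suc (Suc n))"
      using conv[of n] by (simp add: power2_eq_square)
    finally show ?case using pos Suc by simp
  qed
  have "r ^ n * u 0 \<le> u n" for n
  proof (induction n)
    case (Suc n)
    have "r ^ Suc n * u 0 \<le> r * u n"
      using mult_left_mono[OF Suc, of r] r by (simp add: mult.assoc)
    then show ?case using step[of n] by linarith
  qed simp
  moreover obtain n where "K / u 0 < r ^ n"
    using real_arch_pow[OF r] by blast
  ultimately have "K < u n"
    using u0 by (smt (verit) pos_divide_less_eq)
  then show False using K[of n] by (simp add: u_def)
qed

text \<open>
  The inequality for the exponent \<open>r\<close> says that \<open>A powr (r/2) \<cdot> B powr (-r/2)\<close> is a contraction.
  Taking this for \<open>s\<close> and the adjoint of it for \<open>t\<close>, the product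
  \<open>S = B powr (-t/2) \<cdot> A powr c \<cdot> B powr (-s/2)\<close> with \<open>c = (s + t)/2\<close> is a contraction. It is
  similar to the self-adjoint operator \<open>T = B powr (-c/2) \<cdot> A powr c \<cdot> B powr (-c/2)\<close> by way of a power
  of \<open>B\<close>. So the powers of \<open>T\<close> are bounded, hence \<open>T\<close> is itself a contraction, which is the
  inequality for the exponent \<open>c\<close>.
\<close>

lemma op_powr_le_midpoint:
  fixes A B :: "'a::chilbert_space \<Rightarrow>\<^sub>L 'a"
  assumes A: "spectrum_between a b A" "0 < a" and B: "spectrum_between a' b' B" "0 < a'"
    and s: "\<And>x. Re (cinner (op_powr A s x) x) \<le> Re (cinner (op_powr B s x) x)"
    and t: "\<And>x. Re (cinner (op_powr A t x) x) \<le> Re (cinner (op_powr B t x) x)"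
  shows "Re (cinner (op_powr A ((s + t) / 2) x) x) \<le> Re (cinner (op_powr B ((s + t) / 2) x) x)"
proof -
  have X: "norm (op_powr A (r / 2) (op_powr B (- (r / 2)) x)) \<le> norm x"
    if "\<And>x. Re (cinner (op_powr A r x) x) \<le> Re (cinner (op_powr B r x) x)" for r x
  proof (rule power2_le_imp_le)
    show "(norm (op_powr A (r / 2) (op_powr B (- (r / 2)) x)))\<^sup>2 \<le> (norm x)\<^sup>2"
      using that[of "op_powr B (- (r / 2)) x"]
      by (simp add: op_powr_inverse[OF B] flip: norm_op_powr_half[OF A] norm_op_powr_half[OF B])
  qed simp
  define c where "c = (s + t) / 2"
  define Y where "Y = op_powr A (t / 2) o\<^sub>L op_powr B (- (t / 2))"
  define Q where "Q = op_powr B (- (t / 2)) o\<^sub>L op_powr A (t / 2)"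
  have "norm Y \<le> 1"
    by (rule norm_blinfun_bound) (simp_all add: Y_def X[OF t])
  moreover have "norm (Q y) \<le> norm Y * norm y" for y
    by (rule adjoint_norm_le) (simp add: Y_def Q_def op_powr_sym[OF A] op_powr_sym[OF B])
  ultimately have Q: "norm (Q y) \<le> norm y" for y
    by (smt (verit) mult_left_le_one_le norm_ge_zero)
  define S where "S = (\<lambda>x. Q (op_powr A (s / 2) (op_powr B (- (s / 2)) x)))"
  have S: "norm (S x) \<le> norm x" for x
    unfolding S_def using Q X[OF s] by (rule order_trans)
  have Sn: "norm ((S ^^ n) x) \<le> norm x" for n x
    by (induction n) (use S order_trans in auto)
  \<comment> \<open>\<open>D\<close> and its inverse \<open>E\<close> symmetrize \<open>S\<close>: the exponent is \<open>t / 2 - c / 2 = c / 2 - s / 2\<close>.\<close>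
  define D where "D = op_powr B ((t - s) / 4)"
  define E where "E = op_powr B (- ((t - s) / 4))"
  have ED: "E (D x) = x" for x
    unfolding D_def E_def by (rule op_powr_inverse(1)[OF B])
  define T where "T = op_powr B (- (c / 2)) o\<^sub>L op_powr A c o\<^sub>L op_powr B (- (c / 2))"
  have T: "T x = D (S (E x))" for x
  proof -
    have "D (S (E x)) =
      op_powr B ((t - s) / 4 + - (t / 2)) (op_powr A (t / 2 + s / 2) (op_powr B (- (s / 2) + - ((t - s) / 4)) x))"
      by (simp only: D_def E_def S_def Q_def blinfun_apply_blinfun_compose op_powr_powr[OF A] op_powr_powr[OF B])
    moreover have "(t - s) / 4 + - (t / 2) = - (c / 2)" "t / 2 + s / 2 = c"
      "- (s / 2) + - ((t - s) / 4) = - (c / 2)"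
      by (auto simp: c_def field_simps)
    ultimately show ?thesis by (simp only: T_def blinfun_apply_blinfun_compose)
  qed
  have Tn: "(blinfun_apply T ^^ n) (D x) = D ((S ^^ n) x)" for n x
    by (induction n) (simp_all add: T ED)
  have saT: "self_adjoint_op T"
    using op_powr_self_adjoint[OF A] op_powr_self_adjoint[OF B]
    by (simp add: self_adjoint_op_def T_def bounded_op_compose)
  define z where "z = op_powr B (c / 2) x"
  have "norm (T z) \<le> norm z"
  proof (rule self_adjoint_power_bounded_imp_contraction[OF saT])
    fix n
    have "z = D (E z)"
      unfolding D_def E_def by (rule op_powr_inverse(2)[OF B, symmetric])
    then have "norm ((blinfun_apply T ^^ n) z) = norm (D ((S ^^ n) (E z)))"
      by (metis Tn)
    also have "\<dots> \<le> norm (D) * norm ((S ^^ n) (E z))"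
      by (rule norm_blinfun)
    also have "\<dots> \<le> norm (D) * norm (E z)"
      by (intro mult_left_mono Sn) simp
    finally show "norm ((blinfun_apply T ^^ n) z) \<le> norm (D) * norm (E z)" .
  qed
  then have "norm (T z) * norm z \<le> (norm z)\<^sup>2"
    by (simp add: power2_eq_square mult_right_mono)
  moreover have "Re (cinner (T z) z) \<le> norm (T z) * norm z"
    using complex_Re_le_cmod cinner_Cauchy_Schwarz by (rule order_trans)
  moreover have "cinner (T z) z = cinner (op_powr A c x) x"
  proof -
    have "cinner (T z) z = cinner (op_powr A c (op_powr B (- (c / 2)) z)) (op_powr B (- (c / 2)) z)"
      by (simp add: T_def op_powr_sym[OF B])
    also have "op_powr B (- (c / 2)) z = x"
      by (simp add: z_def op_powr_inverse[OF B])
    finally show ?thesis .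
  qed
  ultimately show ?thesis
    by (simp add: z_def norm_op_powr_half[OF B] flip: c_def)
qed

text \<open>
  A point \<open>q\<close> outside the set would lie in a gap between a largest element \<open>u\<close> below it and
  a smallest element \<open>v\<close> above it, but the midpoint of \<open>u\<close> and \<open>v\<close> belongs to the set.
\<close>

lemma midpoint_closed_imp_contains_interval:
  fixes S :: "real set"
  assumes "closed S" "0 \<in> S" "1 \<in> S" and mid: "\<And>x y. x \<in> S \<Longrightarrow> y \<in> S \<Longrightarrow> (x + y) / 2 \<in> S"
  shows "{0..1} \<subseteq> S"
proof
  fix q :: real assume q: "q \<in> {0..1}"
  define u where "u = Sup (S \<inter> {0..q})"
  define v where "v = Inf (S \<inter> {q..1})"
  have u: "u \<in> S \<inter> {0..q}"
    unfolding u_def using assms q by (intro closed_contains_Sup) auto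
  have v: "v \<in> S \<inter> {q..1}"
    unfolding v_def using assms q by (intro closed_contains_Inf) auto
  have m: "(u + v) / 2 \<in> S" using mid u v by blast
  show "q \<in> S"
  proof (cases "(u + v) / 2 \<le> q")
    case True
    then have "(u + v) / 2 \<le> u"
      unfolding u_def using m u v by (intro cSup_upper) (auto simp flip: u_def)
    then have "u = q" using u v by auto
    then show ?thesis using u by blast
  next
    case False
    then have "v \<le> (u + v) / 2"
      using cInf_lower[of "(u + v) / 2" "S \<inter> {q..1}"] m u v by (auto simp: v_def[symmetric])
    then have "v = q" using u v by auto
    then show ?thesis using v by blast
  qed
qed

theorem Loewner_Heinz:
  fixes A B :: "'a::chilbert_space \<Rightarrow>\<^sub>L 'a"
  assumes A: "spectrum_between a b A" "0 < a" and B: "spectrum_between a' b' B" "0 < a'"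
    and le: "A \<preceq> B" and q: "0 \<le> q" "q \<le> 1"
  shows "op_powr A q \<preceq> op_powr B q"
proof -
  define S where "S = (\<Inter>x. {r \<in> {0..1}. Re (cinner (op_powr A r x) x) \<le> Re (cinner (op_powr B r x) x)})"
  have S: "r \<in> S \<longleftrightarrow> r \<in> {0..1} \<and> (\<forall>x. Re (cinner (op_powr A r x) x) \<le> Re (cinner (op_powr B r x) x))" for r
    by (auto simp: S_def)
  have "{0..1} \<subseteq> S"
  proof (rule midpoint_closed_imp_contains_interval)
    show "closed S"
      unfolding S_def
      by (intro closed_INT ballI continuous_on_closed_Collect_le continuous_on_op_powr_form[OF A]
          continuous_on_op_powr_form[OF B] closed_atLeastAtMost)
    show "0 \<in> S" by (simp add: S op_powr_zero[OF A] op_powr_zero[OF B])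
    show "1 \<in> S" by (simp add: S op_powr_one[OF A] op_powr_one[OF B] op_leD[OF le])
    show "(s + t) / 2 \<in> S" if "s \<in> S" "t \<in> S" for s t
      using that op_powr_le_midpoint[OF A B, of s t] unfolding S by auto
  qed
  then have "q \<in> S" using q by auto
  then show ?thesis
    by (simp add: op_le_iff_self_adjoint op_powr_self_adjoint[OF A] op_powr_self_adjoint[OF B] S)
qed

section \<open>The comparison of powers with different exponents\<close>

lemma powr_le_max_endpoints:
  fixes t r :: real
  assumes "0 < m" "m \<le> t" "t \<le> M"
  shows "t powr r \<le> max (m powr r) (M powr r)"
proof (cases "0 \<le> r")
  case True
  then have "t powr r \<le> M powr r" using assms by (intro powr_mono2) auto
  then show ?thesis by simp
next
  case False
  then have "t powr r \<le> m powr r" using assms by (intro powr_mono2') auto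
  then show ?thesis by simp
qed

theorem corollary7:
  fixes A B :: "'a::chilbert_space \<Rightarrow>\<^sub>L 'a"
    and m M s p q :: real
  assumes "positive_op A" and "positive_op B"
    and "m *\<^sub>R id_blinfun \<preceq> A" and "A \<preceq> M *\<^sub>R id_blinfun"
    and "0 < m" and "m < M"
    and "A \<preceq> B"
    and "0 < s" and "s < p" and "p < 1"
    and "s \<le> q" and "q < 1"
    and "M powr (p - 1) * q \<le> (M powr p - m powr p) / (M - m)"
    and "(M powr p - m powr p) / (M - m) \<le> m powr (p - 1) * q"
  shows "op_powr A p \<preceq>
    (2 powr (2 * (1 - s)) * max (m powr (p - q)) (M powr (p - q))) *\<^sub>R op_powr B q"
proof -
  define L where "L = max (m powr (p - q)) (M powr (p - q))"
  have L: "L \<ge> 0" by (simp add: L_def le_max_iff_disj)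
  have lo: "m * (norm x)\<^sup>2 \<le> Re (cinner (A x) x)" for x
    using op_leD[OF assms(3), of x] by (simp add: blinfun.scaleR_left cinner_scaleR_left cinner_self)
  have hi: "Re (cinner (A x) x) \<le> M * (norm x)\<^sup>2" for x
    using op_leD[OF assms(4), of x] by (simp add: blinfun.scaleR_left cinner_scaleR_left cinner_self)
  have A: "spectrum_between m M A"
    by (intro spectrum_betweenI positive_op_imp_self_adjoint assms(1) lo hi)
  have B: "spectrum_between m (norm B) B"
  proof (intro spectrum_betweenI positive_op_imp_self_adjoint assms(2))
    show "m * (norm x)\<^sup>2 \<le> Re (cinner (B x) x)" for x
      using lo op_leD[OF assms(7)] by (rule order_trans)
    show "Re (cinner (B x) x) \<le> norm B * (norm x)\<^sup>2" for x
    proof -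
      have "Re (cinner (B x) x) \<le> norm (B x) * norm x"
        using complex_Re_le_cmod cinner_Cauchy_Schwarz by (rule order_trans)
      also have "\<dots> \<le> norm B * norm x * norm x"
        by (intro mult_right_mono norm_blinfun) simp
      finally show ?thesis by (simp add: power2_eq_square mult.assoc)
    qed
  qed
  note saA = op_powr_self_adjoint[OF A \<open>0 < m\<close>] and saB = op_powr_self_adjoint[OF B \<open>0 < m\<close>]
  have scalar: "Re (cinner (op_powr A p x) x) \<le> L * Re (cinner (op_powr A q x) x)" for x
  proof -
    define y where "y = op_powr A (q / 2) x"
    have "op_powr A p x = op_powr A (q / 2) (op_powr A (p - q) y)"
      by (simp add: y_def op_powr_powr[OF A \<open>0 < m\<close>] field_simps)
    then have "Re (cinner (op_powr A p x) x) = Re (cinner (op_powr A (p - q) y) y)"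
      by (simp add: y_def op_powr_sym[OF A \<open>0 < m\<close>])
    also have "\<dots> \<le> norm (op_powr A (p - q) y) * norm y"
      using complex_Re_le_cmod cinner_Cauchy_Schwarz by (rule order_trans)
    also have "\<dots> \<le> (L * norm y) * norm y"
    proof (intro mult_right_mono)
      have "norm (op_powr A (p - q)) \<le> L"
        unfolding L_def using powr_le_max_endpoints[OF \<open>0 < m\<close>] L
        by (intro norm_op_powr_le[OF A \<open>0 < m\<close>]) (auto simp: L_def)
      then show "norm (op_powr A (p - q) y) \<le> L * norm y"
        by (meson mult_right_mono norm_blinfun norm_ge_zero order_trans)
    qed simp
    also have "\<dots> = L * Re (cinner (op_powr A q x) x)"
      using norm_op_powr_half[OF A \<open>0 < m\<close>, of q x] by (simp add: y_def power2_eq_square mult.assoc)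
    finally show ?thesis .
  qed
  have "op_powr A q \<preceq> op_powr B q"
    using assms by (intro Loewner_Heinz[OF A _ B]) auto
  note LH = op_leD[OF this]
  have two: "1 \<le> (2::real) powr (2 * (1 - s))"
    using assms by (intro ge_one_powr_ge_zero) auto
  have "Re (cinner (op_powr A p x) x) \<le> 2 powr (2 * (1 - s)) * L * Re (cinner (op_powr B q x) x)" for x
  proof -
    have "Re (cinner (op_powr A p x) x) \<le> L * Re (cinner (op_powr B q x) x)"
      using scalar mult_left_mono[OF LH L] by (rule order_trans)
    also have "\<dots> \<le> 2 powr (2 * (1 - s)) * (L * Re (cinner (op_powr B q x) x))"
    proof -
      have "0 \<le> L * Re (cinner (op_powr B q x) x)"
        using L by (simp flip: norm_op_powr_half[OF B \<open>0 < m\<close>])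
      then show ?thesis using mult_right_mono[OF two] by simp
    qed
    finally show ?thesis by (simp add: mult.assoc)
  qed
  then show ?thesis
    unfolding op_le_iff_self_adjoint[OF saA self_adjoint_op_scaleR[OF saB]]
    by (simp add: blinfun.scaleR_left cinner_scaleR_left L_def)
qed

end
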